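(* Let $J$ be a spin ($2J$ a nonnegative integer), let $S$ be an integer with $0\le S\le 2J$, and let $R,Q$ be positive integers with $2R-1\ge 2J+S$ and $Q>2J+S$. Let $x_1,\dots,x_R\in(-1,1)$ be the zeros of the Legendre polynomial $L_R$ of degree $R$, let $$g_\alpha=\frac{2}{(1-x_\alpha^2)\,[L_R'(x_\alpha)]^2},\qquad \phi_\beta=\frac{2\pi\beta}{Q},\qquad w_{\alpha\beta}=\frac{g_\alpha}{2Q}>0,$$ $$\mathbf n_{\alpha\beta}=\Bigl(\sqrt{1-x_\alpha^2}\cos\phi_\beta,\ \sqrt{1-x_\alpha^2}\sin\phi_\beta,\ x_\alpha\Bigr)\in\mathcal S^2,$$ for $\alpha=1,\dots,R$ and $\beta=0,\dots,Q-1$. Then for every operator $A^{(S)}\in\mathcal V_S$, $$A^{(S)}=(2J+1)\sum_{\alpha=1}^{R}\sum_{\beta=0}^{Q-1}w_{\alpha\beta}\,K_{A^{(S)}}(\mathbf n_{\alpha\beta})\,P(\mathbf n_{\alpha\beta}).$$ The minimal choice satisfying the two constraints is $R=\lceil\tfrac12(2J+S+1)\rceil$, $Q=2J+S+1$, for which the number of coherent states used is $RQ=(2J+S+1)\lceil\tfrac12(2J+S+1)\rceil$.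
   Context: Spin coherent states: $\mathcal S^2\subset\mathbb R^3$ is the unit sphere. $\mathcal H_J\cong\mathbb C^{2J+1}$ carries the irreducible spin-$J$ representation $U_J$ of $SU(2)$, with standard orthonormal basis $|Jm\rangle$, $m=-J,\dots,J$, of $J_z$-eigenvectors ($\hbar=1$). For $\mathbf n\in\mathcal S^2$, $|\mathbf n\rangle_J=U_J(R_{\mathbf n})|JJ\rangle$, where $R_{\mathbf n}$ is a rotation taking the north pole $\mathbf e_z$ to $\mathbf n$ (lifted to $SU(2)$), and $P(\mathbf n)=|\mathbf n\rangle\langle\mathbf n|_J$ is the corresponding rank-one projector, which does not depend on the choice of $R_{\mathbf n}$. Irreducible tensor operators: for $0\le K\le 2J$, $-K\le q\le K$, $$T^{(J)}_{Kq}=\sqrt{\frac{2K+1}{2J+1}}\sum_{m,m'=-J}^{J}C^{Jm'}_{Jm,\,Kq}\,|Jm'\rangle\langle Jm|,$$ with $C^{Jm'}_{Jm,\,Kq}=\langle J,m;K,q|J,m'\rangle$ the Clebsch--Gordan coefficients. They form an orthonormal basis of the operators on $\mathcal H_J$ for the Hilbert--Schmidt inner product. The rank-$S$ sector is $\mathcal V_S=\operatorname{span}\{T^{(J)}_{Sq}: q=-S,\dots,S\}$. Contravariant symbol: for $A^{(S)}=\sum_{q=-S}^{S}A_{Sq}T^{(J)}_{Sq}\in\mathcal V_S$, $$K_{A^{(S)}}(\mathbf n)=\frac{4\pi}{(2J+1)\,a_{JS}}\sum_{q=-S}^{S}A_{Sq}Y_{Sq}(\mathbf n),\qquad a_{JS}=\sqrt{\frac{4\pi}{2J+1}}\,C^{JJ}_{JJ,\,S0}=(2J)!\sqrt{\frac{4\pi}{(2J-S)!\,(2J+S+1)!}},$$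 where $Y_{Sq}$ are the standard orthonormal spherical harmonics (Condon--Shortley convention). The Legendre polynomials are those with the standard normalization $L_R(1)=1$. *)

theory Defs
  imports
    "HOL-Analysis.Analysis"
    "HOL-Computational_Algebra.Polynomial"
    "Jordan_Normal_Form.Matrix"
begin

no_notation vec_index (infixl \<open>$\<close> 100)

text \<open>
  A spin \<open>J\<close> is given by the natural number \<open>N = 2J\<close>.  The space \<open>\<complex>\<^sup>2\<^sup>J\<^sup>+\<^sup>1\<close> is written in the standard
  basis ordered by decreasing magnetic quantum number: the index \<open>k \<in> {0..N}\<close> stands for
  \<open>|J m\<rangle>\<close> with \<open>m = J - k\<close>, so that index \<open>0\<close> is \<open>|J J\<rangle>\<close>.
\<close>

abbreviation op_space :: "nat \<Rightarrow> (complex, complex Matrix.mat) module" where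
  "op_space N \<equiv> module_mat TYPE(complex) (N + 1) (N + 1)"

lemma op_space_finsum:
  assumes "\<And>i. i \<in> I \<Longrightarrow> f i \<in> carrier_mat (N + 1) (N + 1)"
  shows "finsum (op_space N) f I = Matrix.mat (N + 1) (N + 1) (\<lambda>p. \<Sum>i\<in>I. f i $$ p)"
proof -
  interpret M: abelian_group "op_space N"
    by (rule abelian_group_mat)
  show ?thesis using assms
  proof (induction I rule: infinite_finite_induct)
    case (infinite I)
    then have "finsum (op_space N) f I = 0\<^sub>m (N + 1) (N + 1)"
      by (simp only: finsum_def finprod_def if_False) (simp add: module_mat_simps)
    then show ?case using infinite by (auto intro!: eq_matI)
  next
    case empty
    show ?case unfolding M.finsum_empty by (auto simp: module_mat_simps)
  next
    case (insert i I)
    have "finsum (op_space N) f (insert i I) = f i + finsum (op_space N) f I"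
      using insert by (subst M.finsum_insert) (auto simp: module_mat_simps)
    also have "finsum (op_space N) f I = Matrix.mat (N + 1) (N + 1) (\<lambda>p. \<Sum>i\<in>I. f i $$ p)"
      using insert by blast
    finally show ?case using insert by (auto intro!: eq_matI)
  qed
qed


section \<open>\<open>SU(2)\<close>, its spin representations, and coherent states\<close>

definition herm :: "complex^2^2 \<Rightarrow> complex^2^2" where
  "herm g = (\<chi> i j. cnj (g $ j $ i))"

definition SU2 :: "(complex^2^2) set" where
  "SU2 = {g. g ** herm g = Finite_Cartesian_Product.mat 1 \<and> Determinants.det g = 1}"

definition pauli_vector :: "real^3 \<Rightarrow> complex^2^2" where
  "pauli_vector v = vector
     [vector [complex_of_real (v $ 3), Complex (v $ 1) (- (v $ 2))],
      vector [Complex (v $ 1) (v $ 2), - complex_of_real (v $ 3)]]"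

text \<open>The two-to-one covering \<open>SU(2) \<rightarrow> SO(3)\<close>: \<open>g (v \<cdot> \<sigma>) g\<^sup>\<dagger> = (R v) \<cdot> \<sigma>\<close>.\<close>

definition lifts_rotation :: "complex^2^2 \<Rightarrow> real^3^3 \<Rightarrow> bool" where
  "lifts_rotation g R \<longleftrightarrow>
     g \<in> SU2 \<and> rotation_matrix R \<and>
     (\<forall>v. g ** pauli_vector v ** herm g = pauli_vector (R *v v))"

definition e_z :: "real^3" where
  "e_z = vector [0, 0, 1]"

text \<open>
  The irreducible representation of spin \<open>N/2\<close> is the action of \<open>g = (a b; c d)\<close> on homogeneous
  polynomials of degree \<open>N\<close> in \<open>u, v\<close> by \<open>u \<mapsto> a u + c v\<close>, \<open>v \<mapsto> b u + d v\<close>, with orthonormal basis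
  \<open>|J m\<rangle> = u\<^sup>J\<^sup>+\<^sup>m v\<^sup>J\<^sup>-\<^sup>m / sqrt ((J+m)! (J-m)!)\<close>.  On it \<open>J\<^sub>z = (u \<partial>\<^sub>u - v \<partial>\<^sub>v) / 2\<close>,
  \<open>J\<^sub>+ = u \<partial>\<^sub>v\<close> and \<open>J\<^sub>- = v \<partial>\<^sub>u\<close> have their standard matrices, and \<open>N = 1\<close> gives \<open>g\<close> itself.
  Below, the polynomials are dehomogenised by \<open>u = 1\<close>.
\<close>

definition spin_rep :: "nat \<Rightarrow> complex^2^2 \<Rightarrow> complex Matrix.mat" where
  "spin_rep N g = Matrix.mat (N + 1) (N + 1) (\<lambda>(i, k).
     complex_of_real (sqrt (fact (N - i) * fact i / (fact (N - k) * fact k))) *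
     coeff ([:g $ 1 $ 1, g $ 2 $ 1:] ^ (N - k) * [:g $ 1 $ 2, g $ 2 $ 2:] ^ k) i)"

text \<open>For \<open>g\<close> lifting a rotation that takes \<open>e_z\<close> to \<open>n\<close>, this is the vector \<open>|n\<rangle>\<^sub>J\<close>.\<close>

definition coherent_state :: "nat \<Rightarrow> complex^2^2 \<Rightarrow> complex Matrix.vec" where
  "coherent_state N g = spin_rep N g *\<^sub>v unit_vec (N + 1) 0"

definition ket_bra :: "complex Matrix.vec \<Rightarrow> complex Matrix.mat" where
  "ket_bra \<psi> = Matrix.mat (dim_vec \<psi>) (dim_vec \<psi>)
     (\<lambda>(i, j). vec_index \<psi> i * cnj (vec_index \<psi> j))"

definition coherent_projector :: "nat \<Rightarrow> complex^2^2 \<Rightarrow> complex Matrix.mat" where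
  "coherent_projector N g = ket_bra (coherent_state N g)"


section \<open>Clebsch--Gordan coefficients and irreducible tensor operators\<close>

abbreviation half_fact :: "int \<Rightarrow> real" where
  "half_fact a \<equiv> fact (nat (a div 2))"

text \<open>
  \<open>clebsch_gordan (2 j\<^sub>1) (2 m\<^sub>1) (2 j\<^sub>2) (2 m\<^sub>2) (2 j) (2 m) = \<langle>j\<^sub>1, m\<^sub>1; j\<^sub>2, m\<^sub>2 | j, m\<rangle>\<close>, by Racah's formula
  (Condon--Shortley phases): all six arguments are doubled, so that they are integers.
  The summation index \<open>s\<close> runs over all values for which no factorial has a negative argument.
\<close>

definition clebsch_gordan :: "int \<Rightarrow> int \<Rightarrow> int \<Rightarrow> int \<Rightarrow> int \<Rightarrow> int \<Rightarrow> real" where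
  "clebsch_gordan a \<alpha> b \<beta> c \<gamma> =
    (if \<alpha> + \<beta> = \<gamma> \<and> \<bar>\<alpha>\<bar> \<le> a \<and> \<bar>\<beta>\<bar> \<le> b \<and> \<bar>\<gamma>\<bar> \<le> c \<and> \<bar>a - b\<bar> \<le> c \<and> c \<le> a + b \<and>
        even (a + b + c) \<and> even (a + \<alpha>) \<and> even (b + \<beta>) \<and> even (c + \<gamma>)
     then
       sqrt (of_int (c + 1) * half_fact (c + a - b) * half_fact (c - a + b) * half_fact (a + b - c)
             / half_fact (a + b + c + 2)) *
       sqrt (half_fact (c + \<gamma>) * half_fact (c - \<gamma>) * half_fact (a - \<alpha>) * half_fact (a + \<alpha>) *
             half_fact (b - \<beta>) * half_fact (b + \<beta>)) *
       (\<Sum>s | 0 \<le> s \<and> 2 * s \<le> a + b - c \<and> 2 * s \<le> a - \<alpha> \<and> 2 * s \<le> b + \<beta> \<and>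
              0 \<le> c - b + \<alpha> + 2 * s \<and> 0 \<le> c - a - \<beta> + 2 * s.
          (- 1) ^ nat s /
          (half_fact (2 * s) * half_fact (a + b - c - 2 * s) * half_fact (a - \<alpha> - 2 * s) *
           half_fact (b + \<beta> - 2 * s) * half_fact (c - b + \<alpha> + 2 * s) *
           half_fact (c - a - \<beta> + 2 * s)))
     else 0)"

definition tensor_op :: "nat \<Rightarrow> nat \<Rightarrow> int \<Rightarrow> complex Matrix.mat" where
  "tensor_op N K q =
     complex_of_real (sqrt (real (2 * K + 1) / real (N + 1))) \<cdot>\<^sub>m
     Matrix.mat (N + 1) (N + 1) (\<lambda>(k', k). complex_of_real
       (clebsch_gordan (int N) (int N - 2 * int k) (2 * int K) (2 * q) (int N) (int N - 2 * int k')))"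

definition tensor_comb :: "nat \<Rightarrow> nat \<Rightarrow> (int \<Rightarrow> complex) \<Rightarrow> complex Matrix.mat" where
  "tensor_comb N S a = (\<Oplus>\<^bsub>op_space N\<^esub>q\<in>{- int S..int S}. a q \<cdot>\<^sub>m tensor_op N S q)"

definition rank_sector :: "nat \<Rightarrow> nat \<Rightarrow> complex Matrix.mat set" where
  "rank_sector N S = range (tensor_comb N S)"

text \<open>
  The coefficients \<open>A\<^sub>S\<^sub>q\<close>, \<open>-S \<le> q \<le> S\<close>, of an operator in the rank-\<open>S\<close> sector, \<open>S \<le> N\<close>; the tensor
  operators are linearly independent, so the choice is unique for these \<open>q\<close>.
\<close>

definition tensor_coeffs :: "nat \<Rightarrow> nat \<Rightarrow> complex Matrix.mat \<Rightarrow> int \<Rightarrow> complex" where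
  "tensor_coeffs N S A = (SOME a. A = tensor_comb N S a)"


section \<open>Legendre polynomials, spherical harmonics and the contravariant symbol\<close>

definition legendre :: "nat \<Rightarrow> real poly" where
  "legendre n = Polynomial.smult (1 / (2 ^ n * fact n)) ((pderiv ^^ n) ([:- 1, 0, 1:] ^ n))"

definition assoc_legendre :: "nat \<Rightarrow> nat \<Rightarrow> real \<Rightarrow> real" where
  "assoc_legendre l m x = (- 1) ^ m * sqrt (1 - x\<^sup>2) ^ m * poly ((pderiv ^^ m) (legendre l)) x"

definition sph_harm_nonneg :: "nat \<Rightarrow> nat \<Rightarrow> real \<Rightarrow> real \<Rightarrow> complex" where
  "sph_harm_nonneg l m \<theta> \<phi> =
     complex_of_real (sqrt (real (2 * l + 1) / (4 * pi) * fact (l - m) / fact (l + m)) *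
                      assoc_legendre l m (cos \<theta>)) * cis (real m * \<phi>)"

definition sph_harm_angles :: "nat \<Rightarrow> int \<Rightarrow> real \<Rightarrow> real \<Rightarrow> complex" where
  "sph_harm_angles l m \<theta> \<phi> =
     (if 0 \<le> m then sph_harm_nonneg l (nat m) \<theta> \<phi>
      else (- 1) ^ nat (- m) * cnj (sph_harm_nonneg l (nat (- m)) \<theta> \<phi>))"

text \<open>At the poles the azimuth is irrelevant (and \<open>Arg 0 = 0\<close>).\<close>

definition sph_harm :: "nat \<Rightarrow> int \<Rightarrow> real^3 \<Rightarrow> complex" where
  "sph_harm l m n = sph_harm_angles l m (arccos (n $ 3)) (Arg (Complex (n $ 1) (n $ 2)))"

definition a_coeff :: "nat \<Rightarrow> nat \<Rightarrow> real" where
  "a_coeff N S = sqrt (4 * pi / real (N + 1)) *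
     clebsch_gordan (int N) (int N) (2 * int S) 0 (int N) (int N)"

definition contravariant_symbol ::
    "nat \<Rightarrow> nat \<Rightarrow> complex Matrix.mat \<Rightarrow> real^3 \<Rightarrow> complex" where
  "contravariant_symbol N S A n =
     complex_of_real (4 * pi / (real (N + 1) * a_coeff N S)) *
     (\<Sum>q\<in>{- int S..int S}. tensor_coeffs N S A q * sph_harm S q n)"


section \<open>The quadrature\<close>

definition gauss_weight :: "nat \<Rightarrow> real \<Rightarrow> real" where
  "gauss_weight R x = 2 / ((1 - x\<^sup>2) * (poly (pderiv (legendre R)) x)\<^sup>2)"

definition azimuth :: "nat \<Rightarrow> nat \<Rightarrow> real" where
  "azimuth Q \<beta> = 2 * pi * real \<beta> / real Q"

definition node_point :: "real \<Rightarrow> real \<Rightarrow> real^3" where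
  "node_point x \<phi> = vector [sqrt (1 - x\<^sup>2) * cos \<phi>, sqrt (1 - x\<^sup>2) * sin \<phi>, x]"

definition admissible :: "nat \<Rightarrow> nat \<Rightarrow> nat \<Rightarrow> nat \<Rightarrow> bool" where
  "admissible N S R Q \<longleftrightarrow> 0 < R \<and> 0 < Q \<and> 2 * R - 1 \<ge> N + S \<and> Q > N + S"

end

theory Submission
  imports Defs
begin

text \<open>
  The matrix entry \<open>(i, j)\<close> of \<open>Y\<^sub>S\<^sub>q(n) P(n)\<close> depends on the azimuth through the
  character of index \<open>q + i - j\<close>, which is below \<open>Q\<close> in modulus; so the sum over \<open>\<beta>\<close> keeps exactly
  the entries with \<open>j = i + q\<close>, those of \<open>T\<^sub>S\<^sub>q\<close>. There the dependence on the height is a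
  polynomial of degree \<open>N + S < 2R\<close>, so the Gauss sum over \<open>\<alpha>\<close> is the integral of
  \<open>(1 - x)\<^sup>q\<^sup>+\<^sup>i (1 + x)\<^sup>q\<^sup>+\<^sup>l\<close> against the \<open>q\<close>-th derivative of the Legendre polynomial, \<open>i + q + l = N\<close>.
  As functions of \<open>i\<close>, these integrals and Racah's sum for the Clebsch--Gordan coefficients
  satisfy, up to factorials, the same three-term recurrence, which identifies them.
\<close>

section \<open>Integration of polynomials\<close>

text \<open>The obstacle is that a general entry of a tensor operator is an alternating sum without
  a product formula, so the two sides cannot be compared by evaluating both. The recurrence that
  replaces evaluation is the Casimir equation \<open>[J, [J, T]] = S (S + 1) T\<close> read along
  the diagonal \<open>j = i + q\<close>, where it is tridiagonal. On the function side it is the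
  differential equation of the \<open>q\<close>-th derivative of the Legendre polynomial,
  self-adjoint for the weight \<open>(1 - x^2)^q\<close>, transferred to
  \<open>(1 - x)^i (1 + x)^l\<close>. Only the start \<open>i = 0\<close> is evaluated outright:
  descending from \<open>q = S\<close>, where the derivative is constant, reduces it to a Beta
  integral. The azimuths have to be summed before the heights: only on the diagonal that survives do
  the square roots in the coherent amplitudes and in the harmonic always combine to a polynomial,
  while elsewhere odd powers of them can remain, for which Gauss quadrature is not exact. The
  computation is made for \<open>q >= 0\<close>; negative \<open>q\<close> follows by
  transposition.\<close>

definition pint :: "real poly \<Rightarrow> real" where
  "pint p = integral {-1..1} (poly p)"

lemma poly_integrable: "(poly p :: real \<Rightarrow> real) integrable_on {a..b}"
  by (intro integrable_continuous_real continuous_intros)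

lemma pint_add: "pint (p + q) = pint p + pint q"
  unfolding pint_def poly_add
  by (rule Henstock_Kurzweil_Integration.integral_add) (rule poly_integrable)+

lemma pint_diff: "pint (p - q) = pint p - pint q"
  unfolding pint_def poly_diff
  by (rule Henstock_Kurzweil_Integration.integral_diff) (rule poly_integrable)+

lemma pint_smult: "pint (Polynomial.smult c p) = c * pint p"
  unfolding pint_def poly_smult by (rule integral_mult_right)

lemma pint_0 [simp]: "pint 0 = 0"
  using pint_diff[of 0 0] by simp

lemma pint_sum: "pint (sum f I) = (\<Sum>i\<in>I. pint (f i))"
  by (induction I rule: infinite_finite_induct) (simp_all add: pint_add)

lemma pint_pderiv: "pint (pderiv p) = poly p 1 - poly p (-1)"
proof -
  have "(poly (pderiv p) has_integral poly p 1 - poly p (-1)) {-1..1}"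
    by (rule fundamental_theorem_of_calculus)
       (auto intro!: has_field_derivative_at_within poly_DERIV
             simp flip: has_real_derivative_iff_has_vector_derivative)
  then show ?thesis by (simp add: pint_def integral_unique)
qed

lemma pint_by_parts:
  "pint (p * pderiv q) = poly (p * q) 1 - poly (p * q) (-1) - pint (pderiv p * q)"
  using pint_pderiv[of "p * q"] by (simp add: pderiv_mult pint_add mult.commute)

section \<open>Legendre polynomials\<close>

lemma pderiv_linear_power_mult:
  fixes h :: "real poly"
  shows "pderiv ([:- a, 1:] ^ Suc n * h)
       = [:- a, 1:] ^ n * (Polynomial.smult (of_nat (Suc n)) h + [:- a, 1:] * pderiv h)"
proof -
  have "pderiv [:- a, 1:] = 1" by (simp add: pderiv_pCons)
  then show ?thesis
    by (simp only: pderiv_mult pderiv_power_Suc)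
       (simp add: algebra_simps del: mult_pCons_left mult_pCons_right of_nat_Suc)
qed

text \<open>All \<open>n\<close> derivatives must fall on the power for anything to survive at
  \<open>a\<close>. Applied to Rodrigues' formula at both endpoints, this gives the values of the
  Legendre polynomial there.\<close>

lemma poly_higher_pderiv_linear_power_mult:
  fixes h :: "real poly"
  shows "poly ((pderiv ^^ n) ([:- a, 1:] ^ n * h)) a = fact n * poly h a"
proof (induction n arbitrary: h)
  case (Suc n)
  show ?case
    by (simp only: funpow_Suc_right o_apply pderiv_linear_power_mult Suc) (simp add: algebra_simps)
qed simp

text \<open>Each derivative lowers the order of a zero by at most one; this is what removes the
  boundary terms at the endpoints.\<close>

lemma linear_power_dvd_higher_pderiv:
  fixes p :: "real poly"
  assumes "[:- a, 1:] ^ (m + n) dvd p"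
  shows "[:- a, 1:] ^ n dvd (pderiv ^^ m) p"
  using assms
proof (induction m arbitrary: n)
  case (Suc m)
  have "[:- a, 1:] ^ Suc n dvd (pderiv ^^ m) p"
    using Suc.prems by (intro Suc.IH) (simp only: add_Suc_shift)
  then obtain h where "(pderiv ^^ m) p = [:- a, 1:] ^ Suc n * h"
    by (elim dvdE)
  then have "(pderiv ^^ Suc m) p
      = [:- a, 1:] ^ n * (Polynomial.smult (of_nat (Suc n)) h + [:- a, 1:] * pderiv h)"
    by (simp only: funpow.simps o_apply pderiv_linear_power_mult)
  then show ?case by (simp only: dvd_triv_left)
qed simp

lemma rodrigues_factor: "[:- 1, 0, 1:] ^ n = [:- 1, 1:] ^ n * [:- (- 1), 1 :: real:] ^ n"
  by (simp flip: power_mult_distrib)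

lemma poly_legendre_1: "poly (legendre n) 1 = 1"
  using poly_higher_pderiv_linear_power_mult[of n 1 "[:- (- 1), 1:] ^ n"]
  by (simp add: legendre_def rodrigues_factor)

lemma poly_legendre_minus_1: "poly (legendre n) (- 1) = (- 1) ^ n"
proof -
  have "(- 2 :: real) ^ n = (- 1) ^ n * 2 ^ n"
    by (simp flip: power_mult_distrib)
  then show ?thesis
    using poly_higher_pderiv_linear_power_mult[of n "- 1" "[:- 1, 1:] ^ n"]
    by (simp add: legendre_def rodrigues_factor mult.commute)
qed

lemma poly_higher_pderiv_rodrigues_endpoint:
  assumes "m < n" "a = 1 \<or> a = (- 1 :: real)"
  shows "poly ((pderiv ^^ m) ([:- 1, 0, 1:] ^ n)) a = 0"
proof -
  have "[:- a, 1:] ^ (m + 1) dvd [:- a, 1:] ^ n"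
    using assms by (intro le_imp_power_dvd) auto
  moreover have "[:- a, 1:] ^ n dvd [:- 1, 0, 1:] ^ n"
    using assms(2) unfolding rodrigues_factor by auto
  ultimately have "[:- a, 1:] ^ 1 dvd (pderiv ^^ m) ([:- 1, 0, 1:] ^ n)"
    by (intro linear_power_dvd_higher_pderiv) (rule dvd_trans)
  then show ?thesis by (simp add: poly_eq_0_iff_dvd)
qed

lemma degree_rodrigues: "Polynomial.degree ([:- 1, 0, 1 :: real:] ^ n) = 2 * n"
  by (simp add: degree_power_eq)

lemma degree_legendre: "Polynomial.degree (legendre n) = n"
  by (simp add: legendre_def degree_higher_pderiv degree_rodrigues)

lemma higher_pderiv_eq_0:
  fixes p :: "real poly"
  assumes "Polynomial.degree p < n"
  shows "(pderiv ^^ n) p = 0"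
proof (rule poly_eqI)
  fix i show "coeff ((pderiv ^^ n) p) i = coeff 0 i"
    using assms by (simp add: coeff_higher_pderiv coeff_eq_0)
qed

lemma higher_pderiv_degree:
  fixes p :: "real poly"
  assumes "Polynomial.degree p = n"
  shows "(pderiv ^^ n) p = [:fact n * lead_coeff p:]"
proof (rule poly_eqI)
  fix i show "coeff ((pderiv ^^ n) p) i = coeff [:fact n * lead_coeff p:] i"
    using assms
    by (cases i) (simp_all add: coeff_higher_pderiv coeff_eq_0 pochhammer_fact)
qed

text \<open>Integration by parts \<open>n\<close> times in Rodrigues' formula:
  \<open>(x^2 - 1)^n\<close> has zeros of order \<open>n\<close> at both ends, so no boundary term
  appears, and \<open>f\<close> is finally differentiated away.\<close>

lemma legendre_orthogonal:
  assumes "Polynomial.degree f < n"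
  shows "pint (legendre n * f) = 0"
proof -
  let ?W = "[:- 1, 0, 1:] ^ n :: real poly"
  have "pint ((pderiv ^^ n) ?W * f) = (- 1) ^ j * pint ((pderiv ^^ (n - j)) ?W * (pderiv ^^ j) f)"
    if "j \<le> n" for j
    using that
  proof (induction j)
    case (Suc j)
    let ?V = "(pderiv ^^ (n - Suc j)) ?W" and ?g = "(pderiv ^^ j) f"
    have "(pderiv ^^ (n - j)) ?W = pderiv ?V"
      using Suc.prems by (metis Suc_diff_Suc Suc_le_eq comp_apply funpow.simps(2))
    moreover have "poly ?V a = 0" if "a = 1 \<or> a = -1" for a
      using Suc.prems that by (intro poly_higher_pderiv_rodrigues_endpoint) auto
    ultimately have "pint ((pderiv ^^ (n - j)) ?W * ?g) = - pint (?V * pderiv ?g)"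
      using pint_by_parts[of ?g ?V] by (simp add: mult.commute)
    then show ?case using Suc by simp
  qed simp
  from this[of n] have "pint ((pderiv ^^ n) ?W * f) = 0"
    using assms by (simp add: higher_pderiv_eq_0)
  then show ?thesis by (simp add: legendre_def pint_smult)
qed

section \<open>Gauss--Legendre quadrature\<close>

text \<open>Interpolation at \<open>R\<close> nodes is exact below degree \<open>R\<close>; division
  by the Legendre polynomial and orthogonality double this. The existence of \<open>R\<close>
  distinct zeros is contained in \<open>zeros\<close>, their simplicity is derived.\<close>

lemma gauss_legendre:
  assumes zeros: "bij_betw x {1..R} {t. - 1 < t \<and> t < 1 \<and> poly (legendre R) t = 0}"
  shows gauss_weight_pos: "\<alpha> \<in> {1..R} \<Longrightarrow> gauss_weight R (x \<alpha>) > 0"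
    and gauss_quadrature: "Polynomial.degree f < 2 * R \<Longrightarrow>
           (\<Sum>\<alpha>\<in>{1..R}. gauss_weight R (x \<alpha>) * poly f (x \<alpha>)) = pint f"
proof -
  let ?L = "legendre R"
  let ?Z = "x ` {1..R}"
  have inj: "inj_on x {1..R}" and Z: "?Z = {t. - 1 < t \<and> t < 1 \<and> poly ?L t = 0}"
    using zeros by (auto simp: bij_betw_def)
  have cardZ: "card ?Z = R"
    using inj by (simp add: card_image)
  have L0: "?L \<noteq> 0" using poly_legendre_1[of R] by auto
  have xZ: "- 1 < x \<alpha>" "x \<alpha> < 1" "poly ?L (x \<alpha>) = 0" if "\<alpha> \<in> {1..R}" for \<alpha>
    using Z that by blast+
  have few_roots: "r = s" if "Polynomial.degree r < R" "Polynomial.degree s < R"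
    "\<And>\<alpha>. \<alpha> \<in> {1..R} \<Longrightarrow> poly r (x \<alpha>) = poly s (x \<alpha>)" for r s
    using that cardZ by (intro poly_eqI_degree[of ?Z]) auto
  \<comment> \<open>The unnormalised Lagrange basis polynomial of the node; its value at the node is
    the derivative of the Legendre polynomial there.\<close>
  define p where "p \<alpha> = ?L div [:- x \<alpha>, 1:]" for \<alpha>
  have p: "?L = [:- x \<alpha>, 1:] * p \<alpha>" if "\<alpha> \<in> {1..R}" for \<alpha>
    using xZ(3)[OF that] unfolding p_def poly_eq_0_iff_dvd by (rule dvd_mult_div_cancel[symmetric])
  have polyL: "poly ?L t = (t - x \<alpha>) * poly (p \<alpha>) t" if "\<alpha> \<in> {1..R}" for \<alpha> t
    unfolding p[OF that] by (simp add: algebra_simps)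
  have degp: "Polynomial.degree (p \<alpha>) = R - 1" if "\<alpha> \<in> {1..R}" for \<alpha>
  proof -
    have "p \<alpha> \<noteq> 0" using p[OF that] L0 by auto
    then have "Polynomial.degree ?L = 1 + Polynomial.degree (p \<alpha>)"
      using degree_mult_eq[of "[:- x \<alpha>, 1:]" "p \<alpha>"] p[OF that] by simp
    then show ?thesis by (simp add: degree_legendre)
  qed
  have pz: "poly (p \<alpha>) (x \<beta>) = 0" if "\<alpha> \<in> {1..R}" "\<beta> \<in> {1..R}" "\<beta> \<noteq> \<alpha>" for \<alpha> \<beta>
  proof -
    have "x \<beta> \<noteq> x \<alpha>" using inj_on_eq_iff[OF inj] that by blast
    then show ?thesis
      using xZ(3)[OF that(2)] by (simp add: polyL[OF that(1)])
  qed
  have pder: "poly (p \<alpha>) (x \<alpha>) = poly (pderiv ?L) (x \<alpha>)" if "\<alpha> \<in> {1..R}" for \<alpha>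
    unfolding p[OF that] by (simp add: pderiv_mult pderiv_pCons del: mult_pCons_left)
  \<comment> \<open>Simplicity of the zeros: otherwise \<open>p \<alpha>\<close>, of degree
    \<open>R - 1\<close>, would vanish at all \<open>R\<close> nodes.\<close>
  have pnz: "poly (p \<alpha>) (x \<alpha>) \<noteq> 0" if "\<alpha> \<in> {1..R}" for \<alpha>
  proof
    assume "poly (p \<alpha>) (x \<alpha>) = 0"
    then have "poly (p \<alpha>) (x \<beta>) = poly 0 (x \<beta>)" if "\<beta> \<in> {1..R}" for \<beta>
      using pz \<open>\<alpha> \<in> {1..R}\<close> that by (cases "\<beta> = \<alpha>") auto
    then have "p \<alpha> = 0"
      using that degp by (intro few_roots) auto
    then show False using p[OF that] L0 by simp
  qed
  define \<mu> where "\<mu> \<alpha> = pint (p \<alpha>) / poly (p \<alpha>) (x \<alpha>)" for \<alpha>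
  have exact: "pint f = (\<Sum>\<alpha>\<in>{1..R}. \<mu> \<alpha> * poly f (x \<alpha>))"
    if "Polynomial.degree f < 2 * R" for f
  proof -
    let ?d = "f div ?L" and ?r = "f mod ?L"
    have f: "f = ?L * ?d + ?r" by simp
    have "R > 0" using that by simp
    have degr: "Polynomial.degree ?r < R"
      using degree_mod_less'[of ?L f] L0 \<open>R > 0\<close> by (cases "?r = 0") (auto simp: degree_legendre)
    have degd: "Polynomial.degree ?d < R"
    proof (cases "?d = 0")
      case False
      have "Polynomial.degree (?L * ?d) = R + Polynomial.degree ?d"
        using False L0 by (simp add: degree_mult_eq degree_legendre)
      moreover have "Polynomial.degree (?L * ?d) < 2 * R"
        unfolding minus_mod_eq_mult_div[symmetric]
        using that degr by (intro degree_diff_less) auto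
      ultimately show ?thesis by simp
    qed (use \<open>R > 0\<close> in simp)
    define s where "s = (\<Sum>\<alpha>\<in>{1..R}. Polynomial.smult (poly ?r (x \<alpha>) / poly (p \<alpha>) (x \<alpha>)) (p \<alpha>))"
    have "?r = s"
    proof (rule few_roots[OF degr])
      show "Polynomial.degree s < R"
        unfolding s_def using \<open>R > 0\<close>
        by (intro le_less_trans[OF degree_sum_le[of _ _ "R - 1"]])
           (auto intro!: order.trans[OF degree_smult_le] simp: degp)
    next
      fix \<beta> assume \<beta>: "\<beta> \<in> {1..R}"
      have "poly s (x \<beta>) = (\<Sum>\<alpha>\<in>{1..R}. if \<alpha> = \<beta> then poly ?r (x \<beta>) else 0)"
        unfolding s_def poly_sum using \<beta> pz pnz by (intro sum.cong) auto
      then show "poly ?r (x \<beta>) = poly s (x \<beta>)" using \<beta> by simp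
    qed
    have "pint f = pint ?r"
      using pint_add[of "?L * ?d" ?r] legendre_orthogonal[OF degd] by simp
    also have "\<dots> = (\<Sum>\<alpha>\<in>{1..R}. \<mu> \<alpha> * poly ?r (x \<alpha>))"
      by (subst \<open>?r = s\<close>) (simp add: s_def pint_sum pint_smult \<mu>_def mult.commute)
    also have "\<dots> = (\<Sum>\<alpha>\<in>{1..R}. \<mu> \<alpha> * poly f (x \<alpha>))"
    proof (rule sum.cong)
      fix \<alpha> assume "\<alpha> \<in> {1..R}"
      then have "poly f (x \<alpha>) = poly ?r (x \<alpha>)"
        using arg_cong[OF f, of "\<lambda>g. poly g (x \<alpha>)"] xZ(3)
        by (simp only: poly_add poly_mult mult_zero_left add_0_left)
      then show "\<mu> \<alpha> * poly ?r (x \<alpha>) = \<mu> \<alpha> * poly f (x \<alpha>)" by simp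
    qed simp
    finally show ?thesis .
  qed
  \<comment> \<open>The closed form comes from testing the exact rule on \<open>p \<alpha>\<close>
    times the derivative of the Legendre polynomial. In the sum only the node
    \<open>x \<alpha>\<close> contributes. In the integral only boundary values remain, the Legendre
    polynomial being orthogonal to the derivative of \<open>p \<alpha>\<close>.\<close>
  have weight: "\<mu> \<alpha> = gauss_weight R (x \<alpha>)" if \<alpha>: "\<alpha> \<in> {1..R}" for \<alpha>
  proof -
    have "R > 0" using \<alpha> by simp
    have degL': "Polynomial.degree (pderiv ?L) = R - 1"
      by (simp add: degree_pderiv degree_legendre)
    have "Polynomial.degree (pderiv (p \<alpha>)) < R"
      using degp[OF \<alpha>] \<open>R > 0\<close> by (simp add: degree_pderiv)
    then have "pint (p \<alpha> * pderiv ?L) = poly (p \<alpha> * ?L) 1 - poly (p \<alpha> * ?L) (-1)"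
      using pint_by_parts[of "p \<alpha>" ?L] legendre_orthogonal by (simp add: mult.commute)
    also have "poly (p \<alpha> * ?L) 1 = 1 / (1 - x \<alpha>)"
    proof -
      have "(1 - x \<alpha>) * poly (p \<alpha>) 1 = 1"
        using poly_legendre_1[of R] by (simp add: polyL[OF \<alpha>])
      then show ?thesis using xZ[OF \<alpha>] by (simp add: poly_legendre_1 field_simps)
    qed
    also have "poly (p \<alpha> * ?L) (-1) = - 1 / (1 + x \<alpha>)"
    proof -
      have "(- 1 - x \<alpha>) * poly (p \<alpha>) (-1) = (-1) ^ R"
        using poly_legendre_minus_1[of R] by (simp add: polyL[OF \<alpha>])
      then have "(- 1 - x \<alpha>) * (poly (p \<alpha>) (-1) * (-1) ^ R) = (-1) ^ R * (-1) ^ R"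
        by (simp only: mult.assoc[symmetric])
      also have "\<dots> = 1" by (simp flip: power_add mult_2)
      finally show ?thesis using xZ[OF \<alpha>] by (simp add: poly_legendre_minus_1 field_simps)
    qed
    also have "1 / (1 - x \<alpha>) - - 1 / (1 + x \<alpha>) = 2 / (1 - (x \<alpha>)\<^sup>2)"
    proof -
      have "1 - (x \<alpha>)\<^sup>2 = (1 - x \<alpha>) * (1 + x \<alpha>)" by (simp add: algebra_simps power2_eq_square)
      then show ?thesis using xZ[OF \<alpha>] by (simp add: field_simps)
    qed
    finally have I: "pint (p \<alpha> * pderiv ?L) = 2 / (1 - (x \<alpha>)\<^sup>2)" .
    have "Polynomial.degree (p \<alpha> * pderiv ?L) < 2 * R"
      using degp[OF \<alpha>] degL' degree_mult_le[of "p \<alpha>" "pderiv ?L"] \<open>R > 0\<close> by linarith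
    then have "pint (p \<alpha> * pderiv ?L)
        = (\<Sum>\<beta>\<in>{1..R}. \<mu> \<beta> * poly (p \<alpha> * pderiv ?L) (x \<beta>))"
      by (rule exact)
    also have "\<dots> = (\<Sum>\<beta>\<in>{1..R}. if \<beta> = \<alpha> then \<mu> \<alpha> * (poly (pderiv ?L) (x \<alpha>))\<^sup>2 else 0)"
      using \<alpha> pz pder by (intro sum.cong) (auto simp: power2_eq_square)
    also have "\<dots> = \<mu> \<alpha> * (poly (pderiv ?L) (x \<alpha>))\<^sup>2" using \<alpha> by simp
    finally have "\<mu> \<alpha> * (poly (pderiv ?L) (x \<alpha>))\<^sup>2 = 2 / (1 - (x \<alpha>)\<^sup>2)"
      using I by simp
    then have "\<mu> \<alpha> = 2 / (1 - (x \<alpha>)\<^sup>2) / (poly (pderiv ?L) (x \<alpha>))\<^sup>2"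
      using pnz[OF \<alpha>] unfolding pder[OF \<alpha>]
      by (metis nonzero_mult_div_cancel_right power_eq_0_iff)
    then show ?thesis by (simp add: gauss_weight_def)
  qed
  show "gauss_weight R (x \<alpha>) > 0" if "\<alpha> \<in> {1..R}"
  proof -
    have "0 < 1 - (x \<alpha>)\<^sup>2" using xZ[OF that] by (simp add: abs_square_less_1)
    then show ?thesis
      using pnz[OF that] by (simp add: pder[OF that] gauss_weight_def)
  qed
  show "(\<Sum>\<alpha>\<in>{1..R}. gauss_weight R (x \<alpha>) * poly f (x \<alpha>)) = pint f"
    if "Polynomial.degree f < 2 * R"
    using exact[OF that] weight by simp
qed

section \<open>Moments of the derivatives of Legendre polynomials\<close>

lemma poly_eq_pointwise: "(\<And>t. poly p t = poly q t) \<Longrightarrow> p = (q :: real poly)"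
  by (simp flip: poly_eq_poly_eq_iff add: fun_eq_iff)

text \<open>For \<open>W = (X^2 - 1)^S\<close> and \<open>c = 2 * S\<close> the assumption is the
  first-order equation of the Rodrigues kernel; the conclusion is this equation differentiated
  \<open>Suc n\<close> times by Leibniz' rule.\<close>

lemma higher_pderiv_rodrigues_ode:
  fixes X W :: "'a :: idom poly"
  assumes X: "pderiv X = 1" and W: "(X * X - 1) * pderiv W = of_nat c * (X * W)"
  shows "(X * X - 1) * (pderiv ^^ Suc (Suc n)) W + of_nat (2 * Suc n) * (X * (pderiv ^^ Suc n) W)
           + of_nat (n * Suc n) * (pderiv ^^ n) W
         = of_nat c * (X * (pderiv ^^ Suc n) W + of_nat (Suc n) * (pderiv ^^ n) W)"
proof (induction n)
  case 0
  show ?case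
    using arg_cong[OF W, of pderiv] by (simp add: X pderiv_mult pderiv_diff algebra_simps)
next
  case (Suc n)
  show ?case
    using arg_cong[OF Suc, of pderiv]
    by (simp add: X pderiv_mult pderiv_add pderiv_diff algebra_simps)
qed

abbreviation legendre_deriv :: "nat \<Rightarrow> nat \<Rightarrow> real poly" where
  "legendre_deriv S q \<equiv> (pderiv ^^ q) (legendre S)"

text \<open>The instance \<open>n = S + q\<close> of the differentiated Rodrigues equation. The
  eigenvalue is \<open>S (S + 1) - q (q + 1)\<close>; the case \<open>q = 0\<close> is Legendre's
  equation.\<close>

lemma legendre_deriv_ode:
  assumes "q \<le> S"
  shows "(1 - t\<^sup>2) * poly (legendre_deriv S (Suc (Suc q))) t
           - 2 * real (Suc q) * t * poly (legendre_deriv S (Suc q)) t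
         = - (real (S - q) * real (S + q + 1)) * poly (legendre_deriv S q) t"
proof -
  let ?X = "[:0, 1:] :: real poly" and ?W = "[:- 1, 0, 1:] ^ S :: real poly"
  define c where "c = 1 / (2 ^ S * fact S :: real)"
  define D where "D n = poly ((pderiv ^^ n) ?W) t" for n
  have X: "pderiv ?X = 1" by (simp add: pderiv_pCons)
  have b: "[:- 1, 0, 1:] = ?X * ?X - 1" by (simp add: one_pCons)
  have "(?X * ?X - 1) * pderiv ?W = of_nat (2 * S) * (?X * ?W)"
  proof (cases S)
    case (Suc m)
    have "pderiv ([:- 1, 0, 1:] :: real poly) = 2 * ?X"
      by (simp add: pderiv_pCons numeral_poly)
    then show ?thesis
      unfolding Suc pderiv_power_Suc b[symmetric]
      by (intro poly_eq_pointwise) (simp add: algebra_simps)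
  qed simp
  from higher_pderiv_rodrigues_ode[OF X this, of "S + q"]
  have "poly ((?X * ?X - 1) * (pderiv ^^ Suc (Suc (S + q))) ?W
           + of_nat (2 * Suc (S + q)) * (?X * (pderiv ^^ Suc (S + q)) ?W)
           + of_nat ((S + q) * Suc (S + q)) * (pderiv ^^ (S + q)) ?W) t
         = poly (of_nat (2 * S) * (?X * (pderiv ^^ Suc (S + q)) ?W
           + of_nat (Suc (S + q)) * (pderiv ^^ (S + q)) ?W)) t"
    by (rule arg_cong)
  then have "(t * t - 1) * D (Suc (Suc (S + q))) + 2 * real (Suc (S + q)) * (t * D (Suc (S + q)))
           + real (S + q) * real (Suc (S + q)) * D (S + q)
         = 2 * real S * (t * D (Suc (S + q)) + real (Suc (S + q)) * D (S + q))"
    by (simp only: poly_mult poly_add poly_diff poly_of_nat poly_numeral poly_1 poly_pCons poly_0 D_def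
        of_nat_mult of_nat_numeral mult_zero_right add_0_right mult_1_right add_0_left)
  then have ode: "(1 - t\<^sup>2) * D (Suc (Suc (S + q))) - 2 * real (Suc q) * t * D (Suc (S + q))
         = - (real (S - q) * real (S + q + 1)) * D (S + q)"
    using assms by (simp add: of_nat_diff algebra_simps power2_eq_square)
  have u: "poly (legendre_deriv S m) t = c * D (S + m)" for m
    by (simp add: legendre_def higher_pderiv_smult c_def D_def funpow_add[symmetric, THEN fun_cong, simplified] add.commute)
  show ?thesis
    unfolding u using arg_cong[OF ode, of "\<lambda>x. c * x"] by (simp add: algebra_simps)
qed

text \<open>Self-adjoint form, with integrating factor \<open>(1 - t^2)^q\<close>. The factor
  \<open>(1 - t^2)^(q + 1)\<close> under the derivative vanishes at both ends, so integration by
  parts leaves no boundary term; both relations between moments rest on this.\<close>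

lemma legendre_deriv_sturm_liouville:
  assumes "q \<le> S"
  shows "pderiv ([:1, 0, - 1:] ^ Suc q * legendre_deriv S (Suc q))
       = Polynomial.smult (- (real (S - q) * real (S + q + 1))) ([:1, 0, - 1:] ^ q * legendre_deriv S q)"
proof (rule poly_eq_pointwise)
  fix t :: real
  have "poly (pderiv ([:1, 0, - 1:] ^ Suc q * legendre_deriv S (Suc q))) t
      = (1 - t\<^sup>2) ^ q * ((1 - t\<^sup>2) * poly (legendre_deriv S (Suc (Suc q))) t
           - 2 * real (Suc q) * t * poly (legendre_deriv S (Suc q)) t)"
    by (simp only: pderiv_mult pderiv_power_Suc)
       (simp add: pderiv_pCons algebra_simps power2_eq_square)
  then show "poly (pderiv ([:1, 0, - 1:] ^ Suc q * legendre_deriv S (Suc q))) t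
     = poly (Polynomial.smult (- (real (S - q) * real (S + q + 1))) ([:1, 0, - 1:] ^ q * legendre_deriv S q)) t"
    by (simp only: legendre_deriv_ode[OF assms]) (simp add: power2_eq_square)
qed

text \<open>Euler's Beta integral moved to the interval from -1 to 1; integration by parts trades
  powers of \<open>1 - t\<close> for powers of \<open>1 + t\<close>.\<close>

lemma pint_jacobi_weight:
  "pint ([:1, - 1:] ^ m * [:1, 1:] ^ n) = 2 ^ (m + n + 1) * fact m * fact n / fact (m + n + 1)"
proof (induction m arbitrary: n)
  case 0
  have "pderiv ([:1, 1:] ^ Suc n) = Polynomial.smult (real (Suc n)) ([:1, 1:] ^ n)"
    unfolding pderiv_power_Suc by (simp add: pderiv_pCons)
  then have "real (Suc n) * pint ([:1, 1:] ^ n) = 2 ^ Suc n"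
    using pint_pderiv[of "[:1, 1:] ^ Suc n"] by (simp add: pint_smult)
  then have "pint ([:1, 1:] ^ n) = 2 ^ Suc n / real (Suc n)"
    by (simp only: eq_divide_eq mult.commute) simp
  then show ?case by (simp del: of_nat_Suc)
next
  case (Suc m)
  have *: "pderiv ([:1, 1:] ^ Suc n) = Polynomial.smult (real (Suc n)) ([:1, 1:] ^ n)"
    "pderiv ([:1, - 1:] ^ Suc m) = Polynomial.smult (- real (Suc m)) ([:1, - 1:] ^ m)"
    unfolding pderiv_power_Suc by (simp_all add: pderiv_pCons)
  have "real (Suc n) * pint ([:1, - 1:] ^ Suc m * [:1, 1:] ^ n)
      = real (Suc m) * pint ([:1, - 1:] ^ m * [:1, 1:] ^ Suc n)"
    using pint_by_parts[of "[:1, - 1:] ^ Suc m" "[:1, 1:] ^ Suc n"]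
    unfolding * mult_smult_left mult_smult_right pint_smult
    by (simp add: algebra_simps del: mult_pCons_left mult_pCons_right)
  then have "pint ([:1, - 1:] ^ Suc m * [:1, 1:] ^ n)
      = real (Suc m) * pint ([:1, - 1:] ^ m * [:1, 1:] ^ Suc n) / real (Suc n)"
    by (metis nonzero_mult_div_cancel_left of_nat_neq_0)
  also have "\<dots> = real (Suc m) * (2 ^ (Suc m + n + 1) * fact m * (real (Suc n) * fact n)
      / fact (Suc m + n + 1)) / real (Suc n)"
    unfolding Suc fact_Suc[of n] by (simp only: add_Suc add_Suc_right of_nat_mult)
  also have "\<dots> = 2 ^ (Suc m + n + 1) * fact (Suc m) * fact n / fact (Suc m + n + 1)"
    unfolding fact_Suc[of m] by (simp del: of_nat_Suc fact_Suc power_Suc)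
  finally show ?case .
qed

text \<open>Up to a constant, the height integral of row \<open>i\<close> and column
  \<open>i + q\<close> when \<open>i + q + l = N\<close>. Both exponents are kept as arguments, so
  the recurrence can be stated without \<open>N\<close>.\<close>

definition legendre_moment :: "nat \<Rightarrow> nat \<Rightarrow> nat \<Rightarrow> nat \<Rightarrow> real" where
  "legendre_moment S q i l = pint ([:1, - 1:] ^ (q + i) * [:1, 1:] ^ (q + l) * legendre_deriv S q)"

lemma legendre_moment_top:
  "legendre_moment S S 0 l
   = fact (2 * S) / (2 ^ S * fact S) * (2 ^ (2 * S + l + 1) * fact S * fact (S + l) / fact (2 * S + l + 1))"
proof -
  have "legendre_deriv S S = Polynomial.smult (1 / (2 ^ S * fact S)) ((pderiv ^^ (2 * S)) ([:- 1, 0, 1:] ^ S))"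
    by (simp add: legendre_def higher_pderiv_smult funpow_add[symmetric, THEN fun_cong, simplified] mult_2)
  also have "\<dots> = [:fact (2 * S) / (2 ^ S * fact S):]"
    by (subst higher_pderiv_degree[OF degree_rodrigues]) (simp add: lead_coeff_power)
  finally have u: "legendre_deriv S S = [:fact (2 * S) / (2 ^ S * fact S):]" .
  have e: "S + (S + l) + 1 = 2 * S + l + 1" by simp
  have "pint (p * [:c:]) = c * pint p" for p c
    by (simp add: pint_smult)
  then show ?thesis
    unfolding legendre_moment_def u by (simp only: pint_jacobi_weight e add_0_right)
qed

text \<open>Integration by parts against \<open>(1 + t)^(l + 1)\<close>, whose derivative is a
  single power: this is special to \<open>i = 0\<close>. It links consecutive \<open>q\<close> at a
  fixed sum of \<open>q\<close> and the last argument.\<close>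

lemma legendre_moment_raise:
  assumes "q \<le> S"
  shows "real (S - q) * real (S + q + 1) * legendre_moment S q 0 (Suc l)
       = real (Suc l) * legendre_moment S (Suc q) 0 l"
proof -
  let ?h = "[:1, 0, - 1:] ^ Suc q * legendre_deriv S (Suc q)"
  let ?p = "[:1, 1:] ^ Suc l :: real poly"
  have sq: "[:1, 0, - 1:] = [:1, - 1:] * [:1, 1 :: real:]" by simp
  have *: "pderiv ?p = Polynomial.smult (real (Suc l)) ([:1, 1:] ^ l)"
    unfolding pderiv_power_Suc by (simp add: pderiv_pCons)
  have "pint (?p * pderiv ?h) = - pint (pderiv ?p * ?h)"
    using pint_by_parts[of ?p ?h] by simp
  also have "pint (pderiv ?p * ?h) = real (Suc l) * legendre_moment S (Suc q) 0 l"
    unfolding * mult_smult_left pint_smult legendre_moment_def sq power_mult_distrib power_add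
    by (simp only: mult_ac add_0_right power_0 mult_1_left)
  also have "pint (?p * pderiv ?h)
      = - (real (S - q) * real (S + q + 1)) * legendre_moment S q 0 (Suc l)"
    unfolding legendre_deriv_sturm_liouville[OF assms] mult_smult_right pint_smult
    unfolding legendre_moment_def sq power_mult_distrib power_add
    by (simp only: mult_ac add_0_right power_0 mult_1_left)
  finally show ?thesis by simp
qed

text \<open>Downward induction on \<open>q\<close> from \<open>q = S\<close> at fixed
  \<open>N\<close>. This is the starting value for the recurrence in \<open>i\<close>.\<close>

lemma legendre_moment_first:
  assumes "q \<le> S" "S \<le> N"
  shows "legendre_moment S q 0 (N - q)
       = 2 ^ (N + 1) * fact N * fact (N - q) * fact (S + q) / (fact (N + S + 1) * fact (N - S) * fact (S - q))"
  using assms(1)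
proof (induction q rule: inc_induct)
  case base
  obtain l where N: "N = S + l"
    using assms(2) le_Suc_ex by blast
  have "(2 :: real) ^ (2 * S + l + 1) = 2 ^ S * 2 ^ (S + l + 1)"
    by (simp flip: power_add)
  note p2 = this
  have e: "S + l + S = 2 * S + l" "S + S = 2 * S"
    by simp_all
  show ?case
    unfolding N add_diff_cancel_left' legendre_moment_top e p2
    by (simp del: fact_Suc power_Suc)
next
  case (step q)
  then obtain a b where ab: "S = q + Suc a" "N = q + Suc b"
    using assms by (metis add_Suc_right less_imp_Suc_add less_le_trans)
  define K where "K = 2 ^ (N + 1) * fact N / (fact (N + S + 1) * fact (N - S) :: real)"
  have "legendre_moment S (Suc q) 0 b = K * fact b * fact (Suc (S + q)) / fact a"
    using step.IH ab(2) ab(1) by (simp add: K_def)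
  moreover have "real (Suc a) * real (Suc (S + q)) * legendre_moment S q 0 (Suc b)
      = real (Suc b) * legendre_moment S (Suc q) 0 b"
    using legendre_moment_raise[of q S b] ab(1) by simp
  ultimately have "real (Suc (S + q)) * (legendre_moment S q 0 (Suc b) * fact (Suc a))
      = real (Suc (S + q)) * (K * fact (Suc b) * fact (S + q))"
    unfolding fact_Suc by (simp add: field_simps del: of_nat_Suc)
  then have "legendre_moment S q 0 (Suc b) = K * fact (Suc b) * fact (S + q) / fact (Suc a)"
    by (simp add: eq_divide_eq del: of_nat_Suc fact_Suc)
  then show ?case
    using ab by (simp add: K_def del: fact_Suc)
qed

text \<open>The symmetric operator of \<open>legendre_deriv_sturm_liouville\<close> is moved onto
  \<open>(1 - t)^i (1 + t)^l\<close>, which it sends to a combination of itself and its two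
  neighbours with the same \<open>i + l\<close>. The truncated \<open>i - 1\<close> and
  \<open>l - 1\<close> are harmless, as their terms carry the factors \<open>i\<close> and
  \<open>l\<close>.\<close>

lemma legendre_moment_recurrence:
  assumes "q \<le> S"
  shows "real i * real (i + q) * legendre_moment S q (i - 1) (l + 1)
       - (real i * real (l + q + 1) + real l * real (i + q + 1)) * legendre_moment S q i l
       + real l * real (l + q) * legendre_moment S q (i + 1) (l - 1)
       = - (real (S - q) * real (S + q + 1)) * legendre_moment S q i l"
proof -
  define a where "a = [:1, - 1 :: real:]"
  define b where "b = [:1, 1 :: real:]"
  let ?u = "legendre_deriv S q"
  let ?h = "[:1, 0, - 1:] ^ Suc q * legendre_deriv S (Suc q)"
  let ?e = "a ^ i * b ^ l"
  \<comment> \<open>This is \<open>(1 - t^2)^(q + 1)\<close> times the derivative of the test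
    function \<open>?e\<close>, so \<open>pderiv g\<close> is the operator applied to
    \<open>?e\<close>, times the weight.\<close>
  define g where "g = Polynomial.smult (real l) (a ^ (i + q + 1) * b ^ (l + q))
    - Polynomial.smult (real i) (a ^ (i + q) * b ^ (l + q + 1))"
  have sq: "[:1, 0, - 1:] = a * b" by (simp add: a_def b_def)
  have D: "pderiv (a ^ m * b ^ n)
      = Polynomial.smult (real n) (a ^ m * b ^ (n - 1)) - Polynomial.smult (real m) (a ^ (m - 1) * b ^ n)"
    for m n
  proof -
    have "pderiv a = - 1" "pderiv b = 1"
      by (simp_all add: a_def b_def pderiv_pCons one_pCons)
    then show ?thesis
      by (simp only: pderiv_mult pderiv_power mult_minus_right mult_1_right
          mult_smult_right smult_minus_right mult.commute[of "b ^ n"] uminus_add_conv_diff diff_conv_add_uminus)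
  qed
  have g: "g = pderiv ?e * [:1, 0, - 1:] ^ Suc q"
  proof -
    have step: "Polynomial.smult (real m) (p ^ (m - 1) * (p * r)) = Polynomial.smult (real m) (p ^ m * r)"
      for m and p r :: "real poly"
      by (cases m) (simp_all add: mult_ac)
    have "pderiv ?e * [:1, 0, - 1:] ^ Suc q
        = Polynomial.smult (real l) (b ^ (l - 1) * (b * (a ^ (i + q + 1) * b ^ q)))
        - Polynomial.smult (real i) (a ^ (i - 1) * (a * (a ^ q * b ^ (l + q + 1))))"
      unfolding sq D by (simp only: power_mult_distrib power_add power_Suc power_one_right
          left_diff_distrib right_diff_distrib mult_smult_left mult_smult_right mult_ac)
    then show ?thesis
      by (simp only: step) (simp only: g_def power_add mult_ac)
  qed
  have i1: "Polynomial.smult (real i * c) (a ^ (i + q - 1) * p) = Polynomial.smult (real i * c) (a ^ (q + (i - 1)) * p)"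
    for c p
    by (cases i) (simp_all add: add.commute)
  have l1: "Polynomial.smult (real l * c) (p * b ^ (l + q - 1)) = Polynomial.smult (real l * c) (p * b ^ (q + (l - 1)))"
    for c p
    by (cases l) (simp_all add: add.commute)
  have g': "pderiv g = Polynomial.smult (real i * real (i + q)) (a ^ (q + (i - 1)) * b ^ (q + (l + 1)))
      - Polynomial.smult (real i * real (l + q + 1) + real l * real (i + q + 1)) (a ^ (q + i) * b ^ (q + l))
      + Polynomial.smult (real l * real (l + q)) (a ^ (q + (i + 1)) * b ^ (q + (l - 1)))"
    unfolding g_def pderiv_diff pderiv_smult D smult_diff_right smult_smult i1 l1 smult_add_left
    by (simp add: ac_simps del: of_nat_add of_nat_Suc power_Suc smult_diff_right)
  have "pint (pderiv g * ?u) = - pint (g * pderiv ?u)"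
    using pint_by_parts[of ?u g] by (simp add: g mult.commute del: mult_pCons_left mult_pCons_right)
  also have "g * pderiv ?u = pderiv ?e * ?h"
    unfolding g by (simp only: mult_ac funpow.simps o_apply)
  also have "pint (pderiv ?e * ?h) = - pint (?e * pderiv ?h)"
    using pint_by_parts[of ?e ?h] by simp
  also have "pint (?e * pderiv ?h) = - (real (S - q) * real (S + q + 1)) * legendre_moment S q i l"
    unfolding legendre_deriv_sturm_liouville[OF assms] mult_smult_right pint_smult
    unfolding legendre_moment_def sq power_mult_distrib power_add
    by (simp only: mult_ac a_def b_def)
  finally show ?thesis
    by (simp only: g' ring_distribs left_diff_distrib mult_smult_left pint_add pint_diff pint_smult
        legendre_moment_def a_def b_def minus_minus)
qed

section \<open>Racah's alternating sum\<close>

text \<open>Racah's sum for equal outer spins, its factorials gathered into binomials, used with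
  \<open>M = N - S\<close>. It is the coefficient of \<open>z^i\<close> in \<open>(1 + z)^M\<close>
  times the polynomial with coefficients
  \<open>(-1)^s (S choose s) (S choose (s + q))\<close>.\<close>

definition racah_sum :: "nat \<Rightarrow> nat \<Rightarrow> nat \<Rightarrow> nat \<Rightarrow> real" where
  "racah_sum S q M i =
     (\<Sum>s\<le>i. (- 1) ^ s * real (S choose s) * real (S choose (s + q)) * real (M choose (i - s)))"

lemma racah_sum_0: "racah_sum S q 0 i = (- 1) ^ i * real (S choose i) * real (S choose (i + q))"
proof -
  have "racah_sum S q 0 i
      = (\<Sum>s\<le>i. if s = i then (- 1) ^ i * real (S choose i) * real (S choose (i + q)) else 0)"
    unfolding racah_sum_def by (rule sum.cong) auto
  then show ?thesis by simp
qed

lemma racah_sum_first: "racah_sum S q M 0 = real (S choose q)"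
  by (simp add: racah_sum_def)

text \<open>The generating function is multiplied by \<open>1 + z\<close>.\<close>

lemma racah_sum_pascal: "racah_sum S q (Suc M) (Suc i) = racah_sum S q M (Suc i) + racah_sum S q M i"
  unfolding racah_sum_def
  by (simp add: Suc_diff_le distrib_left sum.distrib algebra_simps)

lemma of_nat_binomial_Suc:
  "real (Suc k) * real (n choose Suc k) = (real n - real k) * real (n choose k)"
  using gbinomial_mult_1[of "real n" k] unfolding binomial_gbinomial[symmetric] of_nat_id
  by (simp add: binomial_gbinomial algebra_simps)

text \<open>Induction on \<open>M\<close>. For \<open>M = 0\<close> the sum is a single
  hypergeometric term. By Pascal's rule the relation for \<open>Suc M\<close> at \<open>i\<close> is
  the sum of the relations for \<open>M\<close> at \<open>i\<close> and \<open>i - 1\<close>. With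
  \<open>S + M = N\<close> and \<open>l = N - q - i\<close> it becomes
  \<open>legendre_moment_recurrence\<close> after rescaling by factorials.\<close>

lemma racah_sum_recurrence:
  fixes S q :: nat
  defines "R \<equiv> racah_sum S q"
  shows "(real i + 1) * (real i + 1 + real q) * R M (Suc i)
       + ((real S - real q) * (real S + real q + 1)
          - real i * (real S + real M - real i + 1)
          - (real S + real M - real q - real i) * (real i + real q + 1)) * R M i
       + (real S + real M - real q - real i + 1) * (real S + real M - real i + 1)
          * (if i = 0 then 0 else R M (i - 1)) = 0"
proof (induction M arbitrary: i)
  case 0
  define c where "c k = real (S choose k)" for k
  have c: "(real k + 1) * c (Suc k) = (real S - real k) * c k" for k
    using of_nat_binomial_Suc[of k S] by (simp add: c_def add.commute)
  have R: "R 0 k = (- 1) ^ k * c k * c (k + q)" for k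
    by (simp add: R_def racah_sum_0 c_def)
  have up: "(real i + 1) * (real i + 1 + real q) * R 0 (Suc i)
      = - (real S - real i) * (real S - real i - real q) * R 0 i" for i
  proof -
    have "(real i + 1) * (real i + 1 + real q) * R 0 (Suc i)
      = - ((- 1) ^ i * ((real i + 1) * c (Suc i)) * ((real (i + q) + 1) * c (Suc (i + q))))"
      by (simp add: R algebra_simps)
    then show ?thesis unfolding c by (simp add: R algebra_simps)
  qed
  show ?case
  proof (cases i)
    case 0
    then show ?thesis using up[of 0] by (simp add: algebra_simps)
  next
    case (Suc j)
    show ?thesis using up[of i] up[of j] unfolding Suc by (simp add: algebra_simps)
  qed
next
  case (Suc M)
  have R0: "R (Suc M) 0 = R M 0" by (simp add: R_def racah_sum_first)
  have RS: "R (Suc M) (Suc k) = R M (Suc k) + R M k" for k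
    by (simp add: R_def racah_sum_pascal)
  show ?case
  proof (cases i)
    case 0
    then show ?thesis using Suc[of 0] by (simp add: R0 RS algebra_simps)
  next
    case i: (Suc j)
    show ?thesis
    proof (cases j)
      case 0
      then show ?thesis using Suc[of 0] Suc[of 1] i by (simp add: R0 RS algebra_simps)
    next
      case (Suc k)
      then show ?thesis using Suc.IH[of "Suc k"] Suc.IH[of "Suc (Suc k)"] i
        by (simp add: RS algebra_simps)
    qed
  qed
qed

text \<open>
  Both sides solve the same three-term recurrence in \<open>i\<close>, whose leading coefficient does not vanish:
  the moments because the Legendre operator is symmetric, Racah's sums by Pascal's rule in \<open>N\<close>.
\<close>

lemma legendre_moment_eq_racah_sum:
  assumes "q \<le> S" "S \<le> N" "q + i + l = N"
  shows "legendre_moment S q i l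
       = 2 ^ (N + 1) * fact (S + q) / (fact (N + S + 1) * fact (N - S) * fact S)
         * (fact (i + q) * fact i * fact l * fact (l + q)) * racah_sum S q (N - S) i"
  using assms(3)
proof (induction i arbitrary: l rule: less_induct)
  case (less i)
  define K where "K = 2 ^ (N + 1) * fact (S + q) / (fact (N + S + 1) * fact (N - S) * fact S :: real)"
  define R where "R = racah_sum S q (N - S)"
  \<comment> \<open>The factorials that carry one recurrence into the other: their quotient at
    neighbouring indices is the quotient of the two leading coefficients, as \<open>up\<close>
    states.\<close>
  define X where "X i l = (fact (i + q) * fact i * fact l * fact (l + q) :: real)" for i l
  have IH: "legendre_moment S q i' l' = K * X i' l' * R i'" if "i' < i" "q + i' + l' = N" for i' l'
    using less.IH[OF that] by (simp add: K_def X_def R_def)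
  have "legendre_moment S q i l = K * X i l * R i"
  proof (cases i)
    case 0
    have "fact S = fact q * fact (S - q) * real (S choose q)"
      using assms(1) by (simp add: binomial_fact)
    moreover have "l = N - q" using 0 less.prems by simp
    ultimately show ?thesis
      using 0 assms less.prems legendre_moment_first[OF assms(1,2)]
      by (simp add: K_def X_def R_def racah_sum_first mult_ac)
  next
    case (Suc j)
    \<comment> \<open>The recurrence is used at \<open>j = i - 1\<close>, where \<open>p\<close> is
      the partner of \<open>j\<close>; since \<open>p > 0\<close>, the coefficient of the wanted
      moment does not vanish.\<close>
    define p where "p = Suc l"
    have jp: "q + j + p = N" and "real p > 0" using Suc less.prems by (simp_all add: p_def)
    have Mj: "legendre_moment S q j p = K * X j p * R j"
      using Suc jp by (intro IH) auto
    have down: "real j * real (j + q) * legendre_moment S q (j - 1) (p + 1)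
        = (real p + 1) * (real p + real q + 1) * (K * X j p * (if j = 0 then 0 else R (j - 1)))"
    proof (cases j)
      case (Suc k)
      have "legendre_moment S q k (p + 1) = K * X k (p + 1) * R k"
        using \<open>i = Suc j\<close> Suc jp by (intro IH) auto
      then show ?thesis unfolding Suc by (simp add: X_def algebra_simps)
    qed simp
    have up: "real p * (real p + real q) * X (Suc j) l = (real j + 1) * (real j + 1 + real q) * X j p"
      by (simp add: X_def p_def algebra_simps)
    have r: "real S + real (N - S) = real q + real j + real p" "real (S - q) = real S - real q"
      using assms arg_cong[OF jp, of real] by (simp_all add: of_nat_diff)
    define ev where "ev = (real S - real q) * (real S + real q + 1)"
    define B where "B = real j * (real p + real q + 1) + real p * (real j + real q + 1)"
    define C where "C = (real p + 1) * (real p + real q + 1)"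
    define R' where "R' = (if j = 0 then 0 else R (j - 1))"
    have "C * (K * X j p * R') - B * (K * X j p * R j)
        + real p * (real p + real q) * legendre_moment S q (Suc j) l = - ev * (K * X j p * R j)"
      using legendre_moment_recurrence[OF assms(1), of j p]
      unfolding down Mj r C_def B_def R'_def ev_def p_def[symmetric]
      by (simp only: of_nat_add of_nat_1 p_def diff_Suc_1 of_nat_Suc add_ac plus_1_eq_Suc)
    then have "real p * (real p + real q) * legendre_moment S q (Suc j) l
        = K * X j p * ((B - ev) * R j - C * R')"
      by (simp add: right_diff_distrib left_diff_distrib mult_ac)
    also have "(B - ev) * R j - C * R' = (real j + 1) * (real j + 1 + real q) * R (Suc j)"
    proof -
      have "real q + real j + real p - real j + 1 = real p + real q + 1"
        "real q + real j + real p - real q - real j = real p" by simp_all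
      then have "(real j + 1) * (real j + 1 + real q) * R (Suc j) + (ev - B) * R j + C * R' = 0"
        using racah_sum_recurrence[of j q S "N - S"]
        unfolding R_def[symmetric] r R'_def[symmetric]
        by (simp only: ev_def B_def C_def diff_diff_eq)
      then show ?thesis by (simp add: left_diff_distrib)
    qed
    also have "K * X j p * ((real j + 1) * (real j + 1 + real q) * R (Suc j))
        = K * ((real j + 1) * (real j + 1 + real q) * X j p) * R (Suc j)"
      by (simp only: mult_ac)
    also have "\<dots> = real p * (real p + real q) * (K * X (Suc j) l * R (Suc j))"
      unfolding up[symmetric] by (simp only: mult_ac)
    finally show ?thesis
      using \<open>real p > 0\<close> by (simp add: Suc)
  qed
  then show ?case by (simp add: K_def X_def R_def)
qed

section \<open>Clebsch--Gordan coefficients as Racah sums\<close>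

text \<open>Racah's two square roots for outer spins \<open>N / 2\<close>, rank \<open>S\<close> and
  matrix positions \<open>i\<close> and \<open>j\<close>. The final division pays for the three
  factorials spent on turning the summands into binomials.\<close>

definition cg_prefactor :: "nat \<Rightarrow> nat \<Rightarrow> nat \<Rightarrow> nat \<Rightarrow> nat \<Rightarrow> real" where
  "cg_prefactor N S q i j =
     sqrt (real (N + 1) * fact (N - S) * fact S * fact S / fact (N + S + 1))
     * sqrt (fact (N - i) * fact i * fact j * fact (N - j) * fact (S - q) * fact (S + q))
     / (fact S * fact S * fact (N - S))"

lemma real_binomial_fact_div:
  assumes "k \<le> n"
  shows "1 / (fact k * fact (n - k)) = real (n choose k) / fact n"
  using assms by (simp add: binomial_fact)

text \<open>Translates Racah's range of integers into a sum over naturals: in the applications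
  \<open>g\<close> is a product of binomials, which vanishes outside that range.\<close>

lemma sum_shifted_int_atMost:
  fixes f :: "int \<Rightarrow> real"
  assumes A: "\<And>s. s \<in> A \<Longrightarrow> int q \<le> s \<and> s \<le> int q + int n"
    and z: "\<And>t. t \<le> n \<Longrightarrow> int (t + q) \<notin> A \<Longrightarrow> g t = 0"
    and eq: "\<And>t. t \<le> n \<Longrightarrow> int (t + q) \<in> A \<Longrightarrow> f (int (t + q)) = g t"
  shows "sum f A = (\<Sum>t\<le>n. g t)"
proof -
  have "sum f A = (\<Sum>t | t \<le> n \<and> int (t + q) \<in> A. f (int (t + q)))"
  proof (rule sum.reindex_bij_witness[of _ "\<lambda>t. int (t + q)" "\<lambda>s. nat (s - int q)"])
    fix s assume "s \<in> A"
    then show "int (nat (s - int q) + q) = s" "nat (s - int q) \<in> {t. t \<le> n \<and> int (t + q) \<in> A}"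
      "f (int (nat (s - int q) + q)) = f s"
      using A[of s] by auto
  qed auto
  also have "\<dots> = (\<Sum>t | t \<le> n \<and> int (t + q) \<in> A. g t)"
    by (rule sum.cong) (use eq in auto)
  also have "\<dots> = (\<Sum>t\<le>n. g t)"
    by (rule sum.mono_neutral_left) (auto simp: z)
  finally show ?thesis .
qed

lemma half_fact_double: "half_fact (2 * int n) = fact n"
  by simp

lemma of_int_Suc_int: "real_of_int (int n + 1) = real (n + 1)"
  by simp

text \<open>The last condition on Racah's index starts the sum at \<open>s = q\<close>; the shift
  \<open>s = t + q\<close> produces the sign.\<close>

lemma clebsch_gordan_nonneg:
  assumes "S \<le> N" "q \<le> S" "i + q \<le> N"
  shows "clebsch_gordan (int N) (int N - 2 * int (i + q)) (2 * int S) (2 * int q) (int N) (int N - 2 * int i)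
       = (- 1) ^ q * cg_prefactor N S q i (i + q) * racah_sum S q (N - S) i"
proof -
  define A where "A = {s. 0 \<le> s \<and> 2 * s \<le> int N + 2 * int S - int N
      \<and> 2 * s \<le> int N - (int N - 2 * int (i + q)) \<and> 2 * s \<le> 2 * int S + 2 * int q
      \<and> 0 \<le> int N - 2 * int S + (int N - 2 * int (i + q)) + 2 * s
      \<and> 0 \<le> int N - int N - 2 * int q + 2 * s}"
  define f where "f s = (- 1) ^ nat s /
          (half_fact (2 * s) * half_fact (int N + 2 * int S - int N - 2 * s)
           * half_fact (int N - (int N - 2 * int (i + q)) - 2 * s)
           * half_fact (2 * int S + 2 * int q - 2 * s)
           * half_fact (int N - 2 * int S + (int N - 2 * int (i + q)) + 2 * s)
           * half_fact (int N - int N - 2 * int q + 2 * s))" for s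
  define g where "g t = (- 1) ^ q / (fact S * fact S * fact (N - S))
    * ((- 1) ^ t * real (S choose t) * real (S choose (t + q)) * real ((N - S) choose (i - t)))" for t
  have "sum f A = (\<Sum>t\<le>i. g t)"
  proof (rule sum_shifted_int_atMost[where q = q])
    fix t assume "t \<le> i" "int (t + q) \<notin> A"
    then have "S < t + q \<or> N - S < i - t"
      using assms by (auto simp: A_def)
    then show "g t = 0" by (auto simp: g_def)
  next
    fix t assume t: "t \<le> i" and "int (t + q) \<in> A"
    then have le: "t + q \<le> S" "t \<le> S" "i - t \<le> N - S"
      using assms by (auto simp: A_def)
    have h: "int N + 2 * int S - int N - 2 * int (t + q) = 2 * int (S - (t + q))"
      "int N - (int N - 2 * int (i + q)) - 2 * int (t + q) = 2 * int (i - t)"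
      "2 * int S + 2 * int q - 2 * int (t + q) = 2 * int (S - t)"
      "int N - 2 * int S + (int N - 2 * int (i + q)) + 2 * int (t + q) = 2 * int (N - S - (i - t))"
      "int N - int N - 2 * int q + 2 * int (t + q) = 2 * int t"
      using le t assms by simp_all
    have "f (int (t + q)) = (- 1) ^ (t + q) * (1 / (fact t * fact (S - t)))
      * (1 / (fact (t + q) * fact (S - (t + q)))) * (1 / (fact (i - t) * fact (N - S - (i - t))))"
      unfolding f_def h by (simp add: nat_int_add mult_ac)
    also have "\<dots> = g t"
      unfolding real_binomial_fact_div[OF le(1)] real_binomial_fact_div[OF le(2)]
        real_binomial_fact_div[OF le(3)] g_def
      by (simp add: power_add)
    finally show "f (int (t + q)) = g t" .
  qed (auto simp: A_def)
  also have "\<dots> = (- 1) ^ q / (fact S * fact S * fact (N - S)) * racah_sum S q (N - S) i"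
    by (simp add: g_def racah_sum_def sum_distrib_left)
  finally have sum: "sum f A = (- 1) ^ q / (fact S * fact S * fact (N - S)) * racah_sum S q (N - S) i" .
  have h: "int N + int N - 2 * int S = 2 * int (N - S)"
    "int N - int N + 2 * int S = 2 * int S"
    "int N + 2 * int S - int N = 2 * int S"
    "int N + 2 * int S + int N + 2 = 2 * int (N + S + 1)"
    "int N + (int N - 2 * int i) = 2 * int (N - i)"
    "int N - (int N - 2 * int i) = 2 * int i"
    "int N - (int N - 2 * int (i + q)) = 2 * int (i + q)"
    "int N + (int N - 2 * int (i + q)) = 2 * int (N - (i + q))"
    "2 * int S - 2 * int q = 2 * int (S - q)"
    "2 * int S + 2 * int q = 2 * int (S + q)"
    using assms by simp_all
  have "clebsch_gordan (int N) (int N - 2 * int (i + q)) (2 * int S) (2 * int q) (int N) (int N - 2 * int i)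
      = sqrt (of_int (int N + 1) * half_fact (int N + int N - 2 * int S)
          * half_fact (int N - int N + 2 * int S) * half_fact (int N + 2 * int S - int N)
             / half_fact (int N + 2 * int S + int N + 2)) *
       sqrt (half_fact (int N + (int N - 2 * int i)) * half_fact (int N - (int N - 2 * int i))
          * half_fact (int N - (int N - 2 * int (i + q))) * half_fact (int N + (int N - 2 * int (i + q))) *
             half_fact (2 * int S - 2 * int q) * half_fact (2 * int S + 2 * int q)) * sum f A"
    unfolding clebsch_gordan_def f_def A_def using assms by (subst if_P) auto
  also have "\<dots> = (- 1) ^ q * cg_prefactor N S q i (i + q) * racah_sum S q (N - S) i"
    unfolding sum h half_fact_double of_int_Suc_int cg_prefactor_def by (simp del: fact_Suc)
  finally show ?thesis .
qed

text \<open>Here the sum starts at \<open>s = 0\<close>, so no sign appears. The two transposed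
  entries thus differ by \<open>(- 1) ^ q\<close>, just as the harmonics of index \<open>q\<close>
  and \<open>- q\<close> do.\<close>

lemma clebsch_gordan_nonpos:
  assumes "S \<le> N" "q \<le> S" "i + q \<le> N"
  shows "clebsch_gordan (int N) (int N - 2 * int i) (2 * int S) (- 2 * int q) (int N) (int N - 2 * int (i + q))
       = cg_prefactor N S q i (i + q) * racah_sum S q (N - S) i"
proof -
  define A where "A = {s. 0 \<le> s \<and> 2 * s \<le> int N + 2 * int S - int N
      \<and> 2 * s \<le> int N - (int N - 2 * int i) \<and> 2 * s \<le> 2 * int S + - 2 * int q
      \<and> 0 \<le> int N - 2 * int S + (int N - 2 * int i) + 2 * s
      \<and> 0 \<le> int N - int N - - 2 * int q + 2 * s}"
  define f where "f s = (- 1) ^ nat s /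
          (half_fact (2 * s) * half_fact (int N + 2 * int S - int N - 2 * s)
           * half_fact (int N - (int N - 2 * int i) - 2 * s)
           * half_fact (2 * int S + - 2 * int q - 2 * s)
           * half_fact (int N - 2 * int S + (int N - 2 * int i) + 2 * s)
           * half_fact (int N - int N - - 2 * int q + 2 * s))" for s
  define g where "g t = 1 / (fact S * fact S * fact (N - S))
    * ((- 1) ^ t * real (S choose t) * real (S choose (t + q)) * real ((N - S) choose (i - t)))" for t
  have "sum f A = (\<Sum>t\<le>i. g t)"
  proof (rule sum_shifted_int_atMost[where q = 0])
    fix t assume "t \<le> i" "int (t + 0) \<notin> A"
    then have "S < t + q \<or> N - S < i - t"
      using assms by (auto simp: A_def)
    then show "g t = 0" by (auto simp: g_def)
  next
    fix t assume t: "t \<le> i" and "int (t + 0) \<in> A"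
    then have le: "t + q \<le> S" "t \<le> S" "i - t \<le> N - S"
      using assms by (auto simp: A_def)
    have h: "int N + 2 * int S - int N - 2 * int (t + 0) = 2 * int (S - t)"
      "int N - (int N - 2 * int i) - 2 * int (t + 0) = 2 * int (i - t)"
      "2 * int S + - 2 * int q - 2 * int (t + 0) = 2 * int (S - (t + q))"
      "int N - 2 * int S + (int N - 2 * int i) + 2 * int (t + 0) = 2 * int (N - S - (i - t))"
      "int N - int N - - 2 * int q + 2 * int (t + 0) = 2 * int (t + q)"
      using le t assms by simp_all
    have "f (int (t + 0)) = (- 1) ^ t * (1 / (fact t * fact (S - t)))
      * (1 / (fact (t + q) * fact (S - (t + q)))) * (1 / (fact (i - t) * fact (N - S - (i - t))))"
      unfolding f_def h by (simp add: nat_int_add mult_ac)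
    also have "\<dots> = g t"
      unfolding real_binomial_fact_div[OF le(1)] real_binomial_fact_div[OF le(2)]
        real_binomial_fact_div[OF le(3)] g_def
      by simp
    finally show "f (int (t + 0)) = g t" .
  qed (auto simp: A_def)
  also have "\<dots> = 1 / (fact S * fact S * fact (N - S)) * racah_sum S q (N - S) i"
    by (simp add: g_def racah_sum_def sum_distrib_left)
  finally have sum: "sum f A = 1 / (fact S * fact S * fact (N - S)) * racah_sum S q (N - S) i" .
  have h: "int N + int N - 2 * int S = 2 * int (N - S)"
    "int N - int N + 2 * int S = 2 * int S"
    "int N + 2 * int S - int N = 2 * int S"
    "int N + 2 * int S + int N + 2 = 2 * int (N + S + 1)"
    "int N + (int N - 2 * int (i + q)) = 2 * int (N - (i + q))"
    "int N - (int N - 2 * int (i + q)) = 2 * int (i + q)"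
    "int N - (int N - 2 * int i) = 2 * int i"
    "int N + (int N - 2 * int i) = 2 * int (N - i)"
    "2 * int S - - 2 * int q = 2 * int (S + q)"
    "2 * int S + - 2 * int q = 2 * int (S - q)"
    using assms by simp_all
  have "clebsch_gordan (int N) (int N - 2 * int i) (2 * int S) (- 2 * int q) (int N) (int N - 2 * int (i + q))
      = sqrt (of_int (int N + 1) * half_fact (int N + int N - 2 * int S)
          * half_fact (int N - int N + 2 * int S) * half_fact (int N + 2 * int S - int N)
             / half_fact (int N + 2 * int S + int N + 2)) *
       sqrt (half_fact (int N + (int N - 2 * int (i + q))) * half_fact (int N - (int N - 2 * int (i + q)))
          * half_fact (int N - (int N - 2 * int i)) * half_fact (int N + (int N - 2 * int i)) *
             half_fact (2 * int S - - 2 * int q) * half_fact (2 * int S + - 2 * int q)) * sum f A"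
    unfolding clebsch_gordan_def f_def A_def using assms by (subst if_P) auto
  also have "\<dots> = cg_prefactor N S q i (i + q) * racah_sum S q (N - S) i"
    unfolding sum h half_fact_double of_int_Suc_int cg_prefactor_def by (simp add: mult_ac del: fact_Suc)
  finally show ?thesis .
qed

lemma clebsch_gordan_eq_0: "\<alpha> + \<beta> \<noteq> \<gamma> \<Longrightarrow> clebsch_gordan a \<alpha> b \<beta> c \<gamma> = 0"
  by (simp add: clebsch_gordan_def)

section \<open>Coherent projectors, harmonics and tensor operators at the nodes\<close>

text \<open>Column 0 of the representation is the \<open>N\<close>-th power of one linear
  polynomial, so the binomial theorem applies.\<close>

lemma coherent_state_index:
  assumes "i \<le> N"
  shows "vec_index (coherent_state N g) i
       = complex_of_real (sqrt (real (N choose i))) * (g $ 1 $ 1) ^ (N - i) * (g $ 2 $ 1) ^ i"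
proof -
  have "sqrt (fact (N - i) * fact i / fact N) = sqrt (1 / real (N choose i))"
    using assms by (simp add: binomial_fact mult.commute)
  then have "sqrt (fact (N - i) * fact i / fact N) * real (N choose i) = sqrt (real (N choose i))"
    by (simp add: real_sqrt_divide real_div_sqrt)
  then have "complex_of_real (sqrt (fact (N - i) * fact i / fact N)) * of_nat (N choose i)
      = complex_of_real (sqrt (real (N choose i)))"
    by (metis of_real_mult of_real_of_nat_eq)
  moreover have "vec_index (coherent_state N g) i = spin_rep N g $$ (i, 0)"
    using assms unfolding coherent_state_def spin_rep_def
    by (subst index_mult_mat_vec) (auto simp: scalar_prod_right_unit)
  ultimately show ?thesis
    using assms by (simp add: spin_rep_def coeff_linear_poly_power mult_ac)
qed

text \<open>Adding the unitarity relation to the image of the third Pauli matrix cancels the second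
  column of \<open>g\<close>. The phase \<open>u\<close> reflects the freedom in the rotation and
  its lift; it drops out of the projector.\<close>

lemma lifts_rotation_first_column:
  assumes g: "lifts_rotation g Rt" "Rt *v e_z = node_point x \<phi>" and x: "- 1 < x" "x < 1"
  obtains u where "u * cnj u = 1" "g $ 1 $ 1 = u * complex_of_real (sqrt ((1 + x) / 2))"
    "g $ 2 $ 1 = u * complex_of_real (sqrt ((1 - x) / 2)) * cis \<phi>"
proof -
  define \<alpha> where "\<alpha> = sqrt ((1 + x) / 2)"
  define \<gamma> where "\<gamma> = sqrt ((1 - x) / 2)"
  have "\<alpha> > 0" using x by (simp add: \<alpha>_def)
  have \<alpha>2: "\<alpha>\<^sup>2 = (1 + x) / 2" using x by (simp add: \<alpha>_def)
  have \<alpha>\<gamma>: "sqrt (1 - x\<^sup>2) = 2 * \<alpha> * \<gamma>"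
  proof -
    have \<gamma>2: "\<gamma>\<^sup>2 = (1 - x) / 2" and "\<gamma> \<ge> 0" using x by (simp_all add: \<gamma>_def)
    have "(2 * \<alpha> * \<gamma>)\<^sup>2 = 4 * \<alpha>\<^sup>2 * \<gamma>\<^sup>2" by (simp add: power_mult_distrib)
    also have "\<dots> = 1 - x\<^sup>2" unfolding \<alpha>2 \<gamma>2 by (simp add: field_simps power2_eq_square)
    finally have "(2 * \<alpha> * \<gamma>)\<^sup>2 = 1 - x\<^sup>2" .
    then show ?thesis
      using \<open>\<alpha> > 0\<close> \<open>\<gamma> \<ge> 0\<close> by (intro real_sqrt_unique) auto
  qed
  have U: "g ** herm g = Finite_Cartesian_Product.mat 1"
    and V: "g ** pauli_vector e_z ** herm g = pauli_vector (node_point x \<phi>)"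
    using g unfolding lifts_rotation_def SU2_def by (auto dest: spec[of _ e_z])
  have u11: "g $ 1 $ 1 * cnj (g $ 1 $ 1) + g $ 1 $ 2 * cnj (g $ 1 $ 2) = 1"
    and u21: "g $ 2 $ 1 * cnj (g $ 1 $ 1) + g $ 2 $ 2 * cnj (g $ 1 $ 2) = 0"
    using arg_cong[OF U, of "\<lambda>A. A $ 1 $ 1"] arg_cong[OF U, of "\<lambda>A. A $ 2 $ 1"]
    by (simp_all add: matrix_matrix_mult_def herm_def Finite_Cartesian_Product.mat_def sum_2)
  have v11: "g $ 1 $ 1 * cnj (g $ 1 $ 1) - g $ 1 $ 2 * cnj (g $ 1 $ 2) = complex_of_real x"
    and v21: "g $ 2 $ 1 * cnj (g $ 1 $ 1) - g $ 2 $ 2 * cnj (g $ 1 $ 2)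
      = complex_of_real (sqrt (1 - x\<^sup>2)) * cis \<phi>"
    using arg_cong[OF V, of "\<lambda>A. A $ 1 $ 1"] arg_cong[OF V, of "\<lambda>A. A $ 2 $ 1"]
    by (simp_all add: matrix_matrix_mult_def herm_def pauli_vector_def e_z_def node_point_def sum_2
        vector_2 vector_3 complex_eq_iff)
  have "g $ 1 $ 1 * cnj (g $ 1 $ 1) = complex_of_real ((1 + x) / 2)"
  proof -
    have "2 * (g $ 1 $ 1 * cnj (g $ 1 $ 1)) = (g $ 1 $ 1 * cnj (g $ 1 $ 1) + g $ 1 $ 2 * cnj (g $ 1 $ 2))
        + (g $ 1 $ 1 * cnj (g $ 1 $ 1) - g $ 1 $ 2 * cnj (g $ 1 $ 2))"
      by simp
    then show ?thesis unfolding u11 v11 by (simp add: mult_ac)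
  qed
  then have aa: "g $ 1 $ 1 * cnj (g $ 1 $ 1) = (complex_of_real \<alpha>)\<^sup>2"
    by (simp only: \<alpha>2 flip: of_real_power)
  have "2 * (g $ 2 $ 1 * cnj (g $ 1 $ 1)) = complex_of_real (sqrt (1 - x\<^sup>2)) * cis \<phi>"
  proof -
    have "2 * (g $ 2 $ 1 * cnj (g $ 1 $ 1)) = (g $ 2 $ 1 * cnj (g $ 1 $ 1) + g $ 2 $ 2 * cnj (g $ 1 $ 2))
        + (g $ 2 $ 1 * cnj (g $ 1 $ 1) - g $ 2 $ 2 * cnj (g $ 1 $ 2))"
      by simp
    then show ?thesis unfolding u21 v21 by simp
  qed
  then have ca: "g $ 2 $ 1 * cnj (g $ 1 $ 1) = complex_of_real \<alpha> * complex_of_real \<gamma> * cis \<phi>"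
    by (simp add: \<alpha>\<gamma>)
  define u where "u = g $ 1 $ 1 / complex_of_real \<alpha>"
  have a: "g $ 1 $ 1 = u * complex_of_real \<alpha>" using \<open>\<alpha> > 0\<close> by (simp add: u_def)
  have uu: "u * cnj u = 1"
    using aa \<open>\<alpha> > 0\<close> by (simp add: a power2_eq_square mult_ac)
  have "complex_of_real \<alpha> * (g $ 2 $ 1 * cnj u) = complex_of_real \<alpha> * (complex_of_real \<gamma> * cis \<phi>)"
    using ca by (simp add: a mult_ac)
  then have "g $ 2 $ 1 * cnj u = complex_of_real \<gamma> * cis \<phi>"
    using \<open>\<alpha> > 0\<close> by simp
  then have "(u * cnj u) * g $ 2 $ 1 = u * complex_of_real \<gamma> * cis \<phi>"
    by (simp add: mult_ac)
  then have "g $ 2 $ 1 = u * complex_of_real \<gamma> * cis \<phi>"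
    by (simp add: uu)
  then show ?thesis using that uu a unfolding \<alpha>_def \<gamma>_def by blast
qed

definition projector_modulus :: "nat \<Rightarrow> nat \<Rightarrow> nat \<Rightarrow> real \<Rightarrow> real" where
  "projector_modulus N i j x =
     sqrt (real (N choose i)) * sqrt (real (N choose j))
     * sqrt ((1 + x) / 2) ^ (N - i + (N - j)) * sqrt ((1 - x) / 2) ^ (i + j)"

lemma projector_modulus_commute: "projector_modulus N i j = projector_modulus N j i"
  by (simp add: projector_modulus_def fun_eq_iff mult_ac add.commute)

lemma coherent_projector_index:
  assumes g: "lifts_rotation g Rt" "Rt *v e_z = node_point x \<phi>" and x: "- 1 < x" "x < 1"
    and ij: "i \<le> N" "j \<le> N"
  shows "coherent_projector N g $$ (i, j)
       = complex_of_real (projector_modulus N i j x) * cis ((real i - real j) * \<phi>)"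
proof -
  obtain u where u: "u * cnj u = 1" and c: "g $ 1 $ 1 = u * complex_of_real (sqrt ((1 + x) / 2))"
    "g $ 2 $ 1 = u * complex_of_real (sqrt ((1 - x) / 2)) * cis \<phi>"
    using lifts_rotation_first_column[OF g x] by blast
  define \<alpha> where "\<alpha> = sqrt ((1 + x) / 2)"
  define \<gamma> where "\<gamma> = sqrt ((1 - x) / 2)"
  have \<psi>: "vec_index (coherent_state N g) k
      = u ^ N * complex_of_real (sqrt (real (N choose k)) * \<alpha> ^ (N - k) * \<gamma> ^ k) * cis (real k * \<phi>)"
    if "k \<le> N" for k
  proof -
    have "u ^ N = u ^ (N - k) * u ^ k" using that by (simp flip: power_add)
    then show ?thesis
      unfolding coherent_state_index[OF that] c \<alpha>_def[symmetric] \<gamma>_def[symmetric]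
      by (simp add: power_mult_distrib Complex.DeMoivre mult_ac)
  qed
  have "dim_vec (coherent_state N g) = N + 1"
    by (simp add: coherent_state_def spin_rep_def)
  then have "coherent_projector N g $$ (i, j)
      = vec_index (coherent_state N g) i * cnj (vec_index (coherent_state N g) j)"
    using ij by (simp add: coherent_projector_def ket_bra_def)
  also have "\<dots> = (u * cnj u) ^ N * complex_of_real (projector_modulus N i j x)
      * (cis (real i * \<phi>) * cis (- (real j * \<phi>)))"
    unfolding \<psi>[OF ij(1)] \<psi>[OF ij(2)]
    by (simp add: projector_modulus_def \<alpha>_def \<gamma>_def power_mult_distrib power_add cis_cnj mult_ac)
  finally show ?thesis
    by (simp add: u cis_mult left_diff_distrib)
qed

text \<open>The real factor of the harmonic at height \<open>x\<close>. It keeps the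
  Condon--Shortley sign and that of negative \<open>q\<close>, so it is a modulus only up to
  sign.\<close>

definition sph_harm_modulus :: "nat \<Rightarrow> int \<Rightarrow> real \<Rightarrow> real" where
  "sph_harm_modulus S q x =
     (if 0 \<le> q then 1 else (- 1) ^ nat (- q))
     * (sqrt (real (2 * S + 1) / (4 * pi) * fact (S - nat \<bar>q\<bar>) / fact (S + nat \<bar>q\<bar>))
        * assoc_legendre S (nat \<bar>q\<bar>) x)"

lemma sph_harm_node_point:
  assumes x: "- 1 < x" "x < 1"
  shows "sph_harm S q (node_point x \<phi>)
       = complex_of_real (sph_harm_modulus S q x) * cis (real_of_int q * \<phi>)"
proof -
  define z where "z = Complex (sqrt (1 - x\<^sup>2) * cos \<phi>) (sqrt (1 - x\<^sup>2) * sin \<phi>)"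
  have "x\<^sup>2 < 1" using x by (simp add: abs_square_less_1)
  then have pos: "sqrt (1 - x\<^sup>2) > 0" by simp
  have "z = complex_of_real (sqrt (1 - x\<^sup>2)) * cis \<phi>"
    by (simp add: z_def complex_eq_iff)
  \<comment> \<open>\<open>Arg\<close> recovers the azimuth only modulo \<open>2 * pi\<close>, which
    suffices because only integer multiples of it enter.\<close>
  then have "cis (Arg z) = cis \<phi>"
    using pos by (simp add: cis_Arg sgn_mult sgn_of_real sgn_cis)
  then have Arg: "cis (real m * Arg z) = cis (real m * \<phi>)" for m
    by (simp flip: Complex.DeMoivre)
  have n: "node_point x \<phi> $ 3 = x"
    "Complex (node_point x \<phi> $ 1) (node_point x \<phi> $ 2) = z"
    by (simp_all add: node_point_def vector_3 z_def)
  have "cos (arccos x) = x" using x by simp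
  then show ?thesis
    unfolding sph_harm_def n sph_harm_angles_def sph_harm_nonneg_def sph_harm_modulus_def Arg
    by (simp add: cis_cnj)
qed

text \<open>Serves twice: for the vanishing of the geometric sum over azimuths, and for the
  distinctness of nodes on one parallel.\<close>

lemma cis_root_of_unity_eq_1:
  assumes "cis (2 * pi * real_of_int d / real Q) = 1" "\<bar>d\<bar> < int Q"
  shows "d = 0"
proof (rule ccontr)
  assume "d \<noteq> 0"
  have "Q > 0" using assms(2) by linarith
  have "cos (2 * pi * real_of_int d / real Q) = 1"
    using assms(1) by (simp add: complex_eq_iff)
  then obtain k where "2 * pi * real_of_int d / real Q = real_of_int k * (2 * pi)"
    by (auto simp: cos_one_2pi_int)
  then have "real_of_int d = real_of_int k * real Q"
    using \<open>Q > 0\<close> by (simp add: field_simps)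
  then have d: "d = k * int Q"
    by (metis of_int_eq_iff of_int_mult of_int_of_nat_eq)
  then have "1 \<le> \<bar>k\<bar>" using \<open>d \<noteq> 0\<close> by auto
  then have "int Q \<le> \<bar>d\<bar>"
    using mult_right_mono[of 1 "\<bar>k\<bar>" "int Q"] d by (simp add: abs_mult)
  then show False using assms(2) by simp
qed

lemma sum_cis_azimuth:
  assumes "\<bar>d\<bar> < int Q"
  shows "(\<Sum>\<beta>\<in>{0..<Q}. cis (real_of_int d * azimuth Q \<beta>)) = (if d = 0 then of_nat Q else 0)"
proof (cases "d = 0")
  case False
  have "Q > 0" using assms by linarith
  define w where "w = cis (2 * pi * real_of_int d / real Q)"
  have pw: "cis (real_of_int d * azimuth Q \<beta>) = w ^ \<beta>" for \<beta>
    by (simp add: w_def azimuth_def Complex.DeMoivre mult_ac)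
  have "w \<noteq> 1"
    using cis_root_of_unity_eq_1[OF _ assms] False by (auto simp: w_def)
  moreover have "w ^ Q = 1"
  proof -
    have "w ^ Q = cis (2 * pi * real_of_int d)"
      using \<open>Q > 0\<close> by (simp add: w_def Complex.DeMoivre)
    then show ?thesis by (simp add: cis_multiple_2pi)
  qed
  ultimately have "(\<Sum>\<beta>\<in>{0..<Q}. w ^ \<beta>) = 0"
    using geometric_sum[of w Q] by (simp add: atLeast0LessThan)
  then show ?thesis using False by (simp add: pw)
qed simp

section \<open>Quadrature of a single tensor operator\<close>

text \<open>With \<open>sqrt (1 - t^2) = 2 * \<alpha> * \<gamma>\<close> in half-angle terms, the
  total exponents of \<alpha> and \<gamma> are \<open>2 * (q + l)\<close> and
  \<open>2 * (q + i)\<close>; being even, they leave a polynomial.\<close>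

lemma sph_harm_projector_modulus:
  assumes "- 1 < t" "t < 1" and N: "i + q + l = N"
  shows "sph_harm_modulus S (int q) t * projector_modulus N i (i + q) t
       = (- 1) ^ q * sqrt (real (2 * S + 1) / (4 * pi) * fact (S - q) / fact (S + q))
         * (sqrt (real (N choose i)) * sqrt (real (N choose (i + q))) / 2 ^ N)
         * poly ([:1, - 1:] ^ (q + i) * [:1, 1:] ^ (q + l) * legendre_deriv S q) t"
proof -
  define \<alpha> where "\<alpha> = sqrt ((1 + t) / 2)"
  define \<gamma> where "\<gamma> = sqrt ((1 - t) / 2)"
  have \<alpha>2: "\<alpha>\<^sup>2 = (1 + t) / 2" and \<gamma>2: "\<gamma>\<^sup>2 = (1 - t) / 2"
    using assms by (simp_all add: \<alpha>_def \<gamma>_def)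
  have \<rho>: "sqrt (1 - t\<^sup>2) = 2 * (\<alpha> * \<gamma>)"
  proof (rule real_sqrt_unique)
    have "(2 * (\<alpha> * \<gamma>))\<^sup>2 = 4 * \<alpha>\<^sup>2 * \<gamma>\<^sup>2" by (simp add: power_mult_distrib)
    then show "(2 * (\<alpha> * \<gamma>))\<^sup>2 = 1 - t\<^sup>2"
      unfolding \<alpha>2 \<gamma>2 by (simp add: field_simps power2_eq_square)
  qed (use assms in \<open>simp add: \<alpha>_def \<gamma>_def\<close>)
  have e: "N - i + (N - (i + q)) = q + 2 * l" "i + (i + q) = q + 2 * i" using N by simp_all
  have pm: "projector_modulus N i (i + q) t
      = sqrt (real (N choose i)) * sqrt (real (N choose (i + q))) * \<alpha> ^ (q + 2 * l) * \<gamma> ^ (q + 2 * i)"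
    unfolding projector_modulus_def \<alpha>_def \<gamma>_def e by (rule refl)
  have "(2 * (\<alpha> * \<gamma>)) ^ q * (\<alpha> ^ (q + 2 * l) * \<gamma> ^ (q + 2 * i))
      = 2 ^ q * ((\<alpha>\<^sup>2) ^ (q + l) * (\<gamma>\<^sup>2) ^ (q + i))"
    by (simp add: power_mult_distrib power_add power_mult power2_eq_square)
  also have "\<dots> = (1 - t) ^ (q + i) * (1 + t) ^ (q + l) / 2 ^ N"
    unfolding \<alpha>2 \<gamma>2 N[symmetric] by (simp add: power_divide power_add mult_ac)
  finally have "sqrt (1 - t\<^sup>2) ^ q * (\<alpha> ^ (q + 2 * l) * \<gamma> ^ (q + 2 * i))
      = (1 - t) ^ (q + i) * (1 + t) ^ (q + l) / 2 ^ N"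
    by (simp only: \<rho>)
  then have \<rho>': "\<alpha> ^ (q + 2 * l) * (\<gamma> ^ (q + 2 * i) * (sqrt (1 - t\<^sup>2) ^ q * c))
      = (1 - t) ^ (q + i) * (1 + t) ^ (q + l) / 2 ^ N * c" for c
    by (simp only: mult_ac)
  have "poly ([:1, - 1:] ^ (q + i) * [:1, 1:] ^ (q + l) * legendre_deriv S q) t
      = (1 - t) ^ (q + i) * (1 + t) ^ (q + l) * poly (legendre_deriv S q) t"
    by simp
  moreover have "sph_harm_modulus S (int q) t * projector_modulus N i (i + q) t
       = (- 1) ^ q * sqrt (real (2 * S + 1) / (4 * pi) * fact (S - q) / fact (S + q))
         * (sqrt (real (N choose i)) * sqrt (real (N choose (i + q))))
         * (\<alpha> ^ (q + 2 * l) * (\<gamma> ^ (q + 2 * i) * (sqrt (1 - t\<^sup>2) ^ q * poly (legendre_deriv S q) t)))"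
    unfolding pm sph_harm_modulus_def assoc_legendre_def by (simp add: mult_ac)
  ultimately show ?thesis unfolding \<rho>' by (simp only: mult_ac times_divide_eq_left times_divide_eq_right)
qed

lemma quadrature_sph_harm_projector:
  assumes zeros: "bij_betw x {1..R} {t. - 1 < t \<and> t < 1 \<and> poly (legendre R) t = 0}"
    and N: "i + q + l = N" and "q \<le> S" and R: "N + S < 2 * R"
  shows "(\<Sum>\<alpha>\<in>{1..R}. gauss_weight R (x \<alpha>)
            * (sph_harm_modulus S (int q) (x \<alpha>) * projector_modulus N i (i + q) (x \<alpha>)))
       = (- 1) ^ q * sqrt (real (2 * S + 1) / (4 * pi) * fact (S - q) / fact (S + q))
         * (sqrt (real (N choose i)) * sqrt (real (N choose (i + q))) / 2 ^ N) * legendre_moment S q i l"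
proof -
  define c where "c = (- 1) ^ q * sqrt (real (2 * S + 1) / (4 * pi) * fact (S - q) / fact (S + q))
         * (sqrt (real (N choose i)) * sqrt (real (N choose (i + q))) / 2 ^ N)"
  let ?f = "[:1, - 1:] ^ (q + i) * [:1, 1:] ^ (q + l) * legendre_deriv S q :: real poly"
  have "Polynomial.degree ?f \<le> Polynomial.degree ([:1, - 1 :: real:] ^ (q + i))
      + Polynomial.degree ([:1, 1 :: real:] ^ (q + l)) + Polynomial.degree (legendre_deriv S q)"
    by (intro order.trans[OF degree_mult_le] add_mono degree_mult_le order.refl)
  \<comment> \<open>This adds up to \<open>N + S\<close>, the source of the condition on
    \<open>R\<close>.\<close>
  also have "\<dots> = q + i + (q + l) + (S - q)"
    by (simp add: degree_power_eq degree_higher_pderiv degree_legendre)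
  also have "\<dots> < 2 * R" using assms by simp
  finally have deg: "Polynomial.degree ?f < 2 * R" .
  have "gauss_weight R (x \<alpha>)
            * (sph_harm_modulus S (int q) (x \<alpha>) * projector_modulus N i (i + q) (x \<alpha>))
      = c * (gauss_weight R (x \<alpha>) * poly ?f (x \<alpha>))" if "\<alpha> \<in> {1..R}" for \<alpha>
  proof -
    have "- 1 < x \<alpha>" "x \<alpha> < 1" using zeros that by (auto simp: bij_betw_def)
    from sph_harm_projector_modulus[OF this N] show ?thesis
      unfolding c_def by (simp only: mult_ac)
  qed
  then have "(\<Sum>\<alpha>\<in>{1..R}. gauss_weight R (x \<alpha>)
            * (sph_harm_modulus S (int q) (x \<alpha>) * projector_modulus N i (i + q) (x \<alpha>)))
      = (\<Sum>\<alpha>\<in>{1..R}. c * (gauss_weight R (x \<alpha>) * poly ?f (x \<alpha>)))"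
    by (rule sum.cong[OF refl])
  also have "\<dots> = c * pint ?f"
    by (simp only: gauss_quadrature[OF zeros deg] flip: sum_distrib_left)
  finally show ?thesis unfolding c_def legendre_moment_def .
qed

lemma a_coeff_eq:
  assumes "S \<le> N"
  shows "a_coeff N S = sqrt (4 * pi / real (N + 1)) * cg_prefactor N S 0 0 0"
  using clebsch_gordan_nonneg[OF assms, of 0 0] by (simp add: a_coeff_def racah_sum_first)

text \<open>The letters stand for \<open>A = N + 1\<close>, \<open>B = 2 S + 1\<close>,
  \<open>c = 4 pi\<close>, \<open>T = 2^N\<close>, and the factorials \<open>D = (N - S)!\<close>,
  \<open>E = (N + S + 1)!\<close>, \<open>F = S!\<close>, \<open>n = N!\<close>,
  \<open>f1 = (N - i)!\<close>, \<open>f2 = i!\<close>, \<open>f3 = (i + q)!\<close>,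
  \<open>f4 = (N - i - q)!\<close>, \<open>p = (S - q)!\<close>, \<open>m = (S + q)!\<close>.
  Writing them as squares removes the radicals.\<close>

lemma normalisation_identity:
  fixes A B D E F n f1 f2 f3 f4 p m T c :: real
  assumes pos: "A > 0" "B > 0" "D > 0" "E > 0" "F > 0" "n > 0" "f1 > 0" "f2 > 0" "f3 > 0" "f4 > 0"
    "p > 0" "m > 0" "T > 0" "c > 0"
  shows "c / (sqrt (c / A) * (sqrt (A * D * F * F / E) * sqrt (n * n * F * F) / (F * F * D))) / 2
      * (sqrt (B / c * p / m) * (sqrt (n / (f2 * f1)) * sqrt (n / (f3 * f4)) / T)
        * (T * 2 * m / (E * D * F) * (f3 * f2 * f4 * f1)))
      = sqrt (B / A) * (sqrt (A * D * F * F / E) * sqrt (f1 * f2 * f3 * f4 * p * m) / (F * F * D))"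
proof -
  have square: "\<exists>y. y > 0 \<and> x = y\<^sup>2" if "x > 0" for x :: real
    using that by (intro exI[of _ "sqrt x"]) simp
  obtain A' where A: "A' > 0" "A = A'\<^sup>2" using square pos by blast
  obtain B' where B: "B' > 0" "B = B'\<^sup>2" using square pos by blast
  obtain D' where D: "D' > 0" "D = D'\<^sup>2" using square pos by blast
  obtain E' where E: "E' > 0" "E = E'\<^sup>2" using square pos by blast
  obtain f1' where f1: "f1' > 0" "f1 = f1'\<^sup>2" using square pos by blast
  obtain f2' where f2: "f2' > 0" "f2 = f2'\<^sup>2" using square pos by blast
  obtain f3' where f3: "f3' > 0" "f3 = f3'\<^sup>2" using square pos by blast
  obtain f4' where f4: "f4' > 0" "f4 = f4'\<^sup>2" using square pos by blast
  obtain p' where p: "p' > 0" "p = p'\<^sup>2" using square pos by blast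
  obtain m' where m: "m' > 0" "m = m'\<^sup>2" using square pos by blast
  obtain c' where c: "c' > 0" "c = c'\<^sup>2" using square pos by blast
  obtain F' where F: "F' > 0" "F = F'\<^sup>2" using square pos by blast
  have nF: "sqrt (n * n * F * F) = n * F"
    using pos by (intro real_sqrt_unique) (simp_all add: power2_eq_square mult_ac)
  have nf: "sqrt (n / (f2 * f1)) * sqrt (n / (f3 * f4)) = n / sqrt (f2 * f1 * (f3 * f4))"
    using pos by (simp add: real_sqrt_divide real_sqrt_mult)
  show ?thesis
    unfolding nF nf A(2) B(2) D(2) E(2) f1(2) f2(2) f3(2) f4(2) p(2) m(2) c(2) F(2)
    using A(1) B(1) D(1) E(1) f1(1) f2(1) f3(1) f4(1) p(1) m(1) c(1) F(1) \<open>T > 0\<close> \<open>n > 0\<close>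
    by (simp add: real_sqrt_mult real_sqrt_divide) (simp add: field_simps power2_eq_square eval_nat_numeral)
qed

text \<open>In the constant, the factor \<open>2J + 1\<close> of the formula has cancelled that of
  the symbol; the half is that of the weights, whose \<open>1 / Q\<close> is absorbed by the sum
  over azimuths.\<close>

lemma quadrature_tensor_entry:
  assumes zeros: "bij_betw x {1..R} {t. - 1 < t \<and> t < 1 \<and> poly (legendre R) t = 0}"
    and "S \<le> N" "q \<le> S" "i + q \<le> N" and R: "N + S < 2 * R"
  shows "4 * pi / a_coeff N S / 2 * (\<Sum>\<alpha>\<in>{1..R}. gauss_weight R (x \<alpha>)
            * (sph_harm_modulus S (int q) (x \<alpha>) * projector_modulus N i (i + q) (x \<alpha>)))
       = sqrt (real (2 * S + 1) / real (N + 1))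
         * ((- 1) ^ q * cg_prefactor N S q i (i + q) * racah_sum S q (N - S) i)"
proof -
  obtain l where N: "i + q + l = N" using assms(4) le_Suc_ex by blast
  have N': "q + i + l = N" and l: "N - (i + q) = l" "N - i = l + q" using N by simp_all
  have C: "real (N choose i) = fact N / (fact i * fact (N - i))"
    "real (N choose (i + q)) = fact N / (fact (i + q) * fact (N - (i + q)))"
    using assms(4) by (simp_all add: binomial_fact)
  have a: "a_coeff N S = sqrt (4 * pi / real (N + 1))
      * (sqrt (real (N + 1) * fact (N - S) * fact S * fact S / fact (N + S + 1))
         * sqrt (fact N * fact N * fact S * fact S) / (fact S * fact S * fact (N - S)))"
    by (simp add: a_coeff_eq[OF assms(2)] cg_prefactor_def del: fact_Suc of_nat_Suc)
  have "4 * pi / a_coeff N S / 2 * (sqrt (real (2 * S + 1) / (4 * pi) * fact (S - q) / fact (S + q))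
       * (sqrt (real (N choose i)) * sqrt (real (N choose (i + q))) / 2 ^ N)
       * (2 ^ (N + 1) * fact (S + q) / (fact (N + S + 1) * fact (N - S) * fact S)
         * (fact (i + q) * fact i * fact l * fact (l + q))))
     = sqrt (real (2 * S + 1) / real (N + 1)) * cg_prefactor N S q i (i + q)"
    unfolding a C cg_prefactor_def l power_add power_one_right
    by (rule normalisation_identity) simp_all
  note norm = arg_cong[OF this, of "\<lambda>z. (- 1) ^ q * racah_sum S q (N - S) i * z"]
  have "a * (s * y * z * (k * X * r)) = s * r * (a * (y * z * (k * X)))" for a s y z k X r :: real
    by (simp only: mult_ac)
  then show ?thesis
    unfolding quadrature_sph_harm_projector[OF zeros N assms(3) R]
      legendre_moment_eq_racah_sum[OF assms(3,2) N']
    by (simp only: norm) (simp only: mult_ac)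
qed

lemma sph_harm_modulus_uminus:
  "sph_harm_modulus S (- int q) x = (- 1) ^ q * sph_harm_modulus S (int q) x"
  by (simp add: sph_harm_modulus_def)

lemma quadrature_tensor_op:
  assumes zeros: "bij_betw x {1..R} {t. - 1 < t \<and> t < 1 \<and> poly (legendre R) t = 0}"
    and "S \<le> N" and q: "\<bar>q\<bar> \<le> int S" and ij: "i \<le> N" "j \<le> N"
    and R: "N + S < 2 * R" and Q: "N + S < Q"
    and P: "\<And>\<alpha> \<beta>. \<alpha> \<in> {1..R} \<Longrightarrow> \<exists>g Rt. lifts_rotation g Rt \<and>
              Rt *v e_z = node_point (x \<alpha>) (azimuth Q \<beta>) \<and> P \<alpha> \<beta> = coherent_projector N g"
  shows "complex_of_real (4 * pi / a_coeff N S) *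
      (\<Sum>\<alpha>\<in>{1..R}. \<Sum>\<beta>\<in>{0..<Q}. complex_of_real (gauss_weight R (x \<alpha>) / (2 * real Q))
         * (sph_harm S q (node_point (x \<alpha>) (azimuth Q \<beta>)) * P \<alpha> \<beta> $$ (i, j)))
      = tensor_op N S q $$ (i, j)"
proof -
  define h where "h \<alpha> = gauss_weight R (x \<alpha>) * (sph_harm_modulus S q (x \<alpha>) * projector_modulus N i j (x \<alpha>))"
    for \<alpha>
  \<comment> \<open>The total azimuthal frequency of the entry. Its modulus is at most
    \<open>S + N < Q\<close>, which excludes aliasing.\<close>
  define d where "d = q + int i - int j"
  have inner: "(\<Sum>\<beta>\<in>{0..<Q}. complex_of_real (gauss_weight R (x \<alpha>) / (2 * real Q))
         * (sph_harm S q (node_point (x \<alpha>) (azimuth Q \<beta>)) * P \<alpha> \<beta> $$ (i, j)))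
      = (if d = 0 then complex_of_real (h \<alpha> / 2) else 0)" if \<alpha>: "\<alpha> \<in> {1..R}" for \<alpha>
  proof -
    have x: "- 1 < x \<alpha>" "x \<alpha> < 1" using zeros \<alpha> by (auto simp: bij_betw_def)
    have "complex_of_real (gauss_weight R (x \<alpha>) / (2 * real Q))
         * (sph_harm S q (node_point (x \<alpha>) (azimuth Q \<beta>)) * P \<alpha> \<beta> $$ (i, j))
       = complex_of_real (h \<alpha> / (2 * real Q)) * cis (real_of_int d * azimuth Q \<beta>)" for \<beta>
    proof -
      have "P \<alpha> \<beta> $$ (i, j) = complex_of_real (projector_modulus N i j (x \<alpha>))
          * cis ((real i - real j) * azimuth Q \<beta>)"
        using P[OF \<alpha>, of \<beta>] by (auto simp: coherent_projector_index[OF _ _ x ij])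
      moreover have "cis (real_of_int q * azimuth Q \<beta>) * cis ((real i - real j) * azimuth Q \<beta>)
          = cis (real_of_int d * azimuth Q \<beta>)"
        by (simp add: d_def cis_mult algebra_simps)
      ultimately show ?thesis
        unfolding sph_harm_node_point[OF x] h_def by (simp add: mult_ac)
    qed
    then have "(\<Sum>\<beta>\<in>{0..<Q}. complex_of_real (gauss_weight R (x \<alpha>) / (2 * real Q))
         * (sph_harm S q (node_point (x \<alpha>) (azimuth Q \<beta>)) * P \<alpha> \<beta> $$ (i, j)))
      = complex_of_real (h \<alpha> / (2 * real Q)) * (\<Sum>\<beta>\<in>{0..<Q}. cis (real_of_int d * azimuth Q \<beta>))"
      by (simp only: sum_distrib_left)
    also have "(\<Sum>\<beta>\<in>{0..<Q}. cis (real_of_int d * azimuth Q \<beta>)) = (if d = 0 then of_nat Q else 0)"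
      using q ij Q by (intro sum_cis_azimuth) (simp add: d_def)
    finally show ?thesis using Q by simp
  qed
  have T: "tensor_op N S q $$ (i, j) = complex_of_real (sqrt (real (2 * S + 1) / real (N + 1))
      * clebsch_gordan (int N) (int N - 2 * int j) (2 * int S) (2 * q) (int N) (int N - 2 * int i))"
    using ij by (simp add: tensor_op_def)
  show ?thesis
  proof (cases "d = 0")
    case False
    then have "int N - 2 * int j + 2 * q \<noteq> int N - 2 * int i" by (simp add: d_def)
    then have "tensor_op N S q $$ (i, j) = 0" by (simp add: T clebsch_gordan_eq_0)
    moreover have "(\<Sum>\<alpha>\<in>{1..R}. \<Sum>\<beta>\<in>{0..<Q}. complex_of_real (gauss_weight R (x \<alpha>) / (2 * real Q))
         * (sph_harm S q (node_point (x \<alpha>) (azimuth Q \<beta>)) * P \<alpha> \<beta> $$ (i, j))) = 0"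
      using inner False by (intro sum.neutral) simp
    ultimately show ?thesis by (simp only: mult_zero_right)
  next
    case True
    have "4 * pi / a_coeff N S / 2 * sum h {1..R} = sqrt (real (2 * S + 1) / real (N + 1))
      * clebsch_gordan (int N) (int N - 2 * int j) (2 * int S) (2 * q) (int N) (int N - 2 * int i)"
    proof (cases "q \<ge> 0")
      case nonneg: True
      define r where "r = nat q"
      have r: "q = int r" "j = i + r" "r \<le> S"
        using nonneg True q by (simp_all add: r_def d_def)
      show ?thesis
        using quadrature_tensor_entry[OF zeros assms(2) r(3) _ R, of i]
          clebsch_gordan_nonneg[OF assms(2) r(3), of i] ij
        unfolding h_def r by simp
    next
      case neg: False
      \<comment> \<open>The transposed position: the projector factor is symmetric in row and
        column, and the sign of the harmonic cancels the \<open>(- 1) ^ r\<close> of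
        \<open>quadrature_tensor_entry\<close>, in accordance with
        \<open>clebsch_gordan_nonpos\<close>.\<close>
      define r where "r = nat (- q)"
      have r: "q = - int r" "i = j + r" "r \<le> S"
        using neg True q by (simp_all add: r_def d_def)
      have "sum h {1..R} = (- 1) ^ r * (\<Sum>\<alpha>\<in>{1..R}. gauss_weight R (x \<alpha>)
            * (sph_harm_modulus S (int r) (x \<alpha>) * projector_modulus N j (j + r) (x \<alpha>)))"
        unfolding h_def r sph_harm_modulus_uminus projector_modulus_commute[of N "j + r" j]
        by (simp add: sum_distrib_left mult_ac)
      then have "4 * pi / a_coeff N S / 2 * sum h {1..R}
          = (- 1) ^ r * (sqrt (real (2 * S + 1) / real (N + 1))
            * ((- 1) ^ r * cg_prefactor N S r j (j + r) * racah_sum S r (N - S) j))"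
        using quadrature_tensor_entry[OF zeros assms(2) r(3) _ R, of j] ij r(2)
        by (simp only: mult_ac)
      also have "\<dots> = ((- 1) ^ r * (- 1) ^ r) * (sqrt (real (2 * S + 1) / real (N + 1))
            * (cg_prefactor N S r j (j + r) * racah_sum S r (N - S) j))"
        by (simp only: mult_ac)
      also have "(- 1) ^ r * (- 1) ^ r = (1 :: real)" by (simp flip: power_add mult_2)
      finally show ?thesis
        using clebsch_gordan_nonpos[OF assms(2) r(3), of j] ij(1) unfolding r by simp
    qed
    moreover have "complex_of_real (4 * pi / a_coeff N S) * (\<Sum>\<alpha>\<in>{1..R}. complex_of_real (h \<alpha> / 2))
        = complex_of_real (4 * pi / a_coeff N S / 2 * sum h {1..R})"
    proof -
      have "(\<Sum>\<alpha>\<in>{1..R}. complex_of_real (h \<alpha> / 2)) = complex_of_real (sum h {1..R} / 2)"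
        by (simp only: sum_divide_distrib of_real_sum)
      then show ?thesis by (simp only:) simp
    qed
    moreover have "(\<Sum>\<alpha>\<in>{1..R}. \<Sum>\<beta>\<in>{0..<Q}. complex_of_real (gauss_weight R (x \<alpha>) / (2 * real Q))
         * (sph_harm S q (node_point (x \<alpha>) (azimuth Q \<beta>)) * P \<alpha> \<beta> $$ (i, j)))
        = (\<Sum>\<alpha>\<in>{1..R}. complex_of_real (h \<alpha> / 2))"
      using inner True by (intro sum.cong) simp_all
    ultimately show ?thesis by (simp only: T)
  qed
qed

section \<open>The quadrature formula\<close>

lemma norm_node_point:
  assumes "- 1 < x" "x < 1"
  shows "norm (node_point x \<phi>) = 1"
proof -
  have "x\<^sup>2 < 1" using assms by (simp add: abs_square_less_1)
  then have "(sqrt (1 - x\<^sup>2))\<^sup>2 = 1 - x\<^sup>2" by simp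
  then have "(sqrt (1 - x\<^sup>2) * cos \<phi>)\<^sup>2 + (sqrt (1 - x\<^sup>2) * sin \<phi>)\<^sup>2 + x\<^sup>2
      = (1 - x\<^sup>2) * ((cos \<phi>)\<^sup>2 + (sin \<phi>)\<^sup>2) + x\<^sup>2"
    by (simp only: power_mult_distrib distrib_left)
  also have "\<dots> = 1" by simp
  finally show ?thesis
    by (simp add: norm_vec_def L2_set_def sum_3 node_point_def vector_3)
qed

text \<open>Makes the final count one of points, not merely of index pairs. Parallels with
  \<open>\<bar>x\<bar> < 1\<close> have positive radius, so the azimuth can be recovered.\<close>

lemma inj_on_node_point:
  assumes "inj_on x I" and x: "\<And>\<alpha>. \<alpha> \<in> I \<Longrightarrow> - 1 < x \<alpha> \<and> x \<alpha> < 1"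
  shows "inj_on (\<lambda>(\<alpha>, \<beta>). node_point (x \<alpha>) (azimuth Q \<beta>)) (I \<times> {0..<Q})"
proof (rule inj_onI, clarify)
  fix \<alpha> \<beta> \<alpha>' \<beta>'
  assume in_dom: "\<alpha> \<in> I" "\<alpha>' \<in> I" "\<beta> \<in> {0..<Q}" "\<beta>' \<in> {0..<Q}"
    and eq: "node_point (x \<alpha>) (azimuth Q \<beta>) = node_point (x \<alpha>') (azimuth Q \<beta>')"
  have "x \<alpha> = x \<alpha>'"
    using arg_cong[OF eq, of "\<lambda>v. v $ 3"] by (simp add: node_point_def vector_3)
  then have \<alpha>: "\<alpha> = \<alpha>'" using assms(1) in_dom by (auto dest: inj_onD)
  have "(x \<alpha>)\<^sup>2 < 1" using x[OF in_dom(1)] by (auto simp: abs_square_less_1)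
  then have "cos (azimuth Q \<beta>) = cos (azimuth Q \<beta>')" "sin (azimuth Q \<beta>) = sin (azimuth Q \<beta>')"
    using arg_cong[OF eq, of "\<lambda>v. v $ 1"] arg_cong[OF eq, of "\<lambda>v. v $ 2"] \<alpha>
    by (simp_all add: node_point_def vector_3)
  then have "cis (azimuth Q \<beta>) = cis (azimuth Q \<beta>')" by (simp add: complex_eq_iff)
  then have "cis (azimuth Q \<beta> - azimuth Q \<beta>') = 1" by (simp flip: cis_divide)
  moreover have "azimuth Q \<beta> - azimuth Q \<beta>' = 2 * pi * real_of_int (int \<beta> - int \<beta>') / real Q"
    by (simp add: azimuth_def right_diff_distrib diff_divide_distrib)
  ultimately have "int \<beta> - int \<beta>' = 0"
    using in_dom by (intro cis_root_of_unity_eq_1[of _ Q]) auto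
  then show "\<alpha> = \<alpha>' \<and> \<beta> = \<beta>'" using \<alpha> by simp
qed

lemma carrier_tensor_op: "tensor_op N S q \<in> carrier_mat (N + 1) (N + 1)"
  by (simp add: tensor_op_def)

lemma carrier_coherent_projector: "coherent_projector N g \<in> carrier_mat (N + 1) (N + 1)"
  by (simp add: coherent_projector_def ket_bra_def coherent_state_def spin_rep_def)

lemma tensor_comb_index:
  assumes "i \<le> N" "j \<le> N"
  shows "tensor_comb N S a $$ (i, j) = (\<Sum>q\<in>{- int S..int S}. a q * tensor_op N S q $$ (i, j))"
proof -
  have "(a q \<cdot>\<^sub>m tensor_op N S q) $$ (i, j) = a q * tensor_op N S q $$ (i, j)" for q
    using carrier_tensor_op[of N S q] assms by (intro index_smult_mat) auto
  moreover have "a q \<cdot>\<^sub>m tensor_op N S q \<in> carrier_mat (N + 1) (N + 1)" for q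
    using carrier_tensor_op by (rule smult_carrier_mat)
  ultimately show ?thesis
    using assms unfolding tensor_comb_def by (subst op_space_finsum) auto
qed

lemma tensor_comb_tensor_coeffs:
  "A \<in> rank_sector N S \<Longrightarrow> A = tensor_comb N S (tensor_coeffs N S A)"
  unfolding rank_sector_def tensor_coeffs_def
  by (rule someI_ex[of "\<lambda>a. A = tensor_comb N S a"]) blast

lemma nat_ceiling_half_le_iff:
  "nat \<lceil>(real N + real S + 1) / 2\<rceil> \<le> R \<longleftrightarrow> N + S + 1 \<le> 2 * R"
proof -
  have "nat \<lceil>(real N + real S + 1) / 2\<rceil> \<le> R \<longleftrightarrow> real (N + S + 1) \<le> real (2 * R)"
    by (simp add: nat_le_iff ceiling_le_iff field_simps)
  then show ?thesis by (simp only: of_nat_le_iff)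
qed

theorem mainTheorem2:
  fixes N S R Q :: nat
    and x :: "nat \<Rightarrow> real"
    and w :: "nat \<Rightarrow> nat \<Rightarrow> real"
    and nn :: "nat \<Rightarrow> nat \<Rightarrow> real^3"
    and Rot :: "real^3 \<Rightarrow> real^3^3"
    and lift :: "real^3 \<Rightarrow> complex^2^2"
    and P :: "real^3 \<Rightarrow> complex Matrix.mat"
    and Rmin Qmin :: nat
  assumes S: "S \<le> N"
    and RQ: "admissible N S R Q"
    and zeros: "bij_betw x {1..R} {t. - 1 < t \<and> t < 1 \<and> poly (legendre R) t = 0}"
    and w: "\<And>\<alpha> \<beta>. w \<alpha> \<beta> = gauss_weight R (x \<alpha>) / (2 * real Q)"
    and nn: "\<And>\<alpha> \<beta>. nn \<alpha> \<beta> = node_point (x \<alpha>) (azimuth Q \<beta>)"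
    and lift: "\<And>n. n \<in> sphere 0 1 \<Longrightarrow> lifts_rotation (lift n) (Rot n) \<and> Rot n *v e_z = n"
    and P: "\<And>n. P n = coherent_projector N (lift n)"
    and Rmin: "Rmin = nat \<lceil>(real N + real S + 1) / 2\<rceil>"
    and Qmin: "Qmin = N + S + 1"
  shows "(\<forall>\<alpha>\<in>{1..R}. \<forall>\<beta>\<in>{0..<Q}. 0 < w \<alpha> \<beta> \<and> nn \<alpha> \<beta> \<in> sphere 0 1) \<and>
    (\<forall>A\<in>rank_sector N S.
       A = of_nat (N + 1) \<cdot>\<^sub>m
         (\<Oplus>\<^bsub>op_space N\<^esub>\<alpha>\<in>{1..R}. \<Oplus>\<^bsub>op_space N\<^esub>\<beta>\<in>{0..<Q}.
            (complex_of_real (w \<alpha> \<beta>) * contravariant_symbol N S A (nn \<alpha> \<beta>)) \<cdot>\<^sub>m P (nn \<alpha> \<beta>))) \<and>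
    admissible N S Rmin Qmin \<and>
    (\<forall>R' Q'. admissible N S R' Q' \<longrightarrow> Rmin \<le> R' \<and> Qmin \<le> Q') \<and>
    (R = Rmin \<and> Q = Qmin \<longrightarrow>
       card ((\<lambda>(\<alpha>, \<beta>). nn \<alpha> \<beta>) ` ({1..R} \<times> {0..<Q})) = R * Q \<and>
       R * Q = (N + S + 1) * nat \<lceil>(real N + real S + 1) / 2\<rceil>)"
proof -
  have R2: "N + S < 2 * R" and QNS: "N + S < Q" using RQ by (auto simp: admissible_def)
  have xZ: "- 1 < x \<alpha>" "x \<alpha> < 1" if "\<alpha> \<in> {1..R}" for \<alpha>
    using zeros that by (auto simp: bij_betw_def)
  have sphere: "nn \<alpha> \<beta> \<in> sphere 0 1" if "\<alpha> \<in> {1..R}" for \<alpha> \<beta>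
    using norm_node_point[OF xZ[OF that]] by (simp add: nn)
  have wpos: "0 < w \<alpha> \<beta>" if "\<alpha> \<in> {1..R}" for \<alpha> \<beta>
    using gauss_weight_pos[OF zeros that] QNS by (simp add: w)
  have PC: "P n \<in> carrier_mat (N + 1) (N + 1)" for n
    unfolding P by (rule carrier_coherent_projector)
  have formula: "A = of_nat (N + 1) \<cdot>\<^sub>m
         (\<Oplus>\<^bsub>op_space N\<^esub>\<alpha>\<in>{1..R}. \<Oplus>\<^bsub>op_space N\<^esub>\<beta>\<in>{0..<Q}.
            (complex_of_real (w \<alpha> \<beta>) * contravariant_symbol N S A (nn \<alpha> \<beta>)) \<cdot>\<^sub>m P (nn \<alpha> \<beta>))"
    (is "A = of_nat (N + 1) \<cdot>\<^sub>m ?rhs") if "A \<in> rank_sector N S" for A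
  proof -
    define a where "a = tensor_coeffs N S A"
    have A: "A = tensor_comb N S a"
      unfolding a_def using that by (rule tensor_comb_tensor_coeffs)
    define c where "c \<alpha> \<beta> = complex_of_real (w \<alpha> \<beta>) * contravariant_symbol N S A (nn \<alpha> \<beta>)" for \<alpha> \<beta>
    \<comment> \<open>Sums in the module of operators become entrywise sums, which leaves an
      identity of complex numbers for each entry.\<close>
    have inner: "(\<Oplus>\<^bsub>op_space N\<^esub>\<beta>\<in>{0..<Q}. c \<alpha> \<beta> \<cdot>\<^sub>m P (nn \<alpha> \<beta>))
        = Matrix.mat (N + 1) (N + 1) (\<lambda>p. \<Sum>\<beta>\<in>{0..<Q}. (c \<alpha> \<beta> \<cdot>\<^sub>m P (nn \<alpha> \<beta>)) $$ p)" for \<alpha>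
      using PC by (intro op_space_finsum smult_carrier_mat)
    have rhs: "?rhs = Matrix.mat (N + 1) (N + 1) (\<lambda>p. \<Sum>\<alpha>\<in>{1..R}.
        Matrix.mat (N + 1) (N + 1) (\<lambda>p. \<Sum>\<beta>\<in>{0..<Q}. (c \<alpha> \<beta> \<cdot>\<^sub>m P (nn \<alpha> \<beta>)) $$ p) $$ p)"
      unfolding c_def[symmetric] inner by (rule op_space_finsum) simp
    have dims: "dim_row ?rhs = N + 1" "dim_col ?rhs = N + 1"
      by (simp_all only: rhs dim_row_mat dim_col_mat)
    have dimA: "A \<in> carrier_mat (N + 1) (N + 1)"
    proof -
      have "tensor_comb N S a = Matrix.mat (N + 1) (N + 1)
          (\<lambda>p. \<Sum>q\<in>{- int S..int S}. (a q \<cdot>\<^sub>m tensor_op N S q) $$ p)"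
        unfolding tensor_comb_def by (intro op_space_finsum smult_carrier_mat carrier_tensor_op)
      then show ?thesis by (simp add: A)
    qed
    show ?thesis
    proof (rule eq_matI)
      fix i j
      assume "i < dim_row (of_nat (N + 1) \<cdot>\<^sub>m ?rhs)" "j < dim_col (of_nat (N + 1) \<cdot>\<^sub>m ?rhs)"
      then have ij: "i < N + 1" "j < N + 1" "i \<le> N" "j \<le> N"
        unfolding index_smult_mat dims by simp_all
      define k where "k = complex_of_real (4 * pi / (real (N + 1) * a_coeff N S))"
      define Y where "Y q \<alpha> \<beta> = complex_of_real (gauss_weight R (x \<alpha>) / (2 * real Q))
        * (sph_harm S q (node_point (x \<alpha>) (azimuth Q \<beta>)) * P (nn \<alpha> \<beta>) $$ (i, j))" for q \<alpha> \<beta>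
      have k: "of_nat (N + 1) * k = complex_of_real (4 * pi / a_coeff N S)"
      proof -
        have "real (N + 1) * (4 * pi / (real (N + 1) * a_coeff N S)) = 4 * pi / a_coeff N S"
          by (simp del: of_nat_Suc of_nat_add)
        then show ?thesis unfolding k_def by (metis of_real_mult of_real_of_nat_eq)
      qed
      have cY: "(c \<alpha> \<beta> \<cdot>\<^sub>m P (nn \<alpha> \<beta>)) $$ (i, j) = (\<Sum>q\<in>{- int S..int S}. k * a q * Y q \<alpha> \<beta>)" for \<alpha> \<beta>
      proof -
        have "(c \<alpha> \<beta> \<cdot>\<^sub>m P (nn \<alpha> \<beta>)) $$ (i, j) = c \<alpha> \<beta> * P (nn \<alpha> \<beta>) $$ (i, j)"
          using PC[of "nn \<alpha> \<beta>"] ij by (intro index_smult_mat) auto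
        also have "\<dots> = (\<Sum>q\<in>{- int S..int S}. k * a q * Y q \<alpha> \<beta>)"
          unfolding c_def contravariant_symbol_def k_def[symmetric] a_def[symmetric] w nn Y_def
            sum_distrib_left sum_distrib_right
          by (simp only: mult_ac)
        finally show ?thesis .
      qed
      have T: "complex_of_real (4 * pi / a_coeff N S) * (\<Sum>\<alpha>\<in>{1..R}. \<Sum>\<beta>\<in>{0..<Q}. Y q \<alpha> \<beta>)
          = tensor_op N S q $$ (i, j)" if "q \<in> {- int S..int S}" for q
        unfolding Y_def
      proof (rule quadrature_tensor_op[OF zeros S _ ij(3,4) R2 QNS])
        show "\<bar>q\<bar> \<le> int S" using that by auto
        fix \<alpha> \<beta> assume "\<alpha> \<in> {1..R}"
        then show "\<exists>g Rt. lifts_rotation g Rt \<and> Rt *v e_z = node_point (x \<alpha>) (azimuth Q \<beta>)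
            \<and> P (nn \<alpha> \<beta>) = coherent_projector N g"
          using lift[OF sphere, of \<alpha> \<beta>] unfolding P nn by blast
      qed
      have "(of_nat (N + 1) \<cdot>\<^sub>m ?rhs) $$ (i, j)
          = of_nat (N + 1) * (\<Sum>\<alpha>\<in>{1..R}. \<Sum>\<beta>\<in>{0..<Q}. \<Sum>q\<in>{- int S..int S}. k * a q * Y q \<alpha> \<beta>)"
        using ij unfolding rhs by (simp add: cY del: of_nat_Suc of_nat_add)
      \<comment> \<open>With the sum over \<open>q\<close> outermost, each tensor operator is
        reproduced on its own.\<close>
      also have "(\<Sum>\<alpha>\<in>{1..R}. \<Sum>\<beta>\<in>{0..<Q}. \<Sum>q\<in>{- int S..int S}. k * a q * Y q \<alpha> \<beta>)
          = (\<Sum>q\<in>{- int S..int S}. k * a q * (\<Sum>\<alpha>\<in>{1..R}. \<Sum>\<beta>\<in>{0..<Q}. Y q \<alpha> \<beta>))"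
        unfolding sum_distrib_left sum.swap[of _ "{- int S..int S}" "{0..<Q}"]
        by (rule sum.swap)
      also have "of_nat (N + 1) * \<dots> = (\<Sum>q\<in>{- int S..int S}. a q
          * ((of_nat (N + 1) * k) * (\<Sum>\<alpha>\<in>{1..R}. \<Sum>\<beta>\<in>{0..<Q}. Y q \<alpha> \<beta>)))"
        unfolding sum_distrib_left[of "of_nat (N + 1)"] by (simp only: mult_ac)
      also have "\<dots> = (\<Sum>q\<in>{- int S..int S}. a q * tensor_op N S q $$ (i, j))"
        unfolding k using T by (intro sum.cong) simp_all
      also have "\<dots> = A $$ (i, j)"
        unfolding A using ij by (simp add: tensor_comb_index)
      finally show "A $$ (i, j) = (of_nat (N + 1) \<cdot>\<^sub>m ?rhs) $$ (i, j)" by simp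
    qed (unfold index_smult_mat dims, use dimA in auto)
  qed
  \<comment> \<open>For \<open>0 < R'\<close> the truncated condition
    \<open>N + S \<le> 2 * R' - 1\<close> in \<open>admissible\<close> is the right-hand
    side.\<close>
  have Rmin_le: "Rmin \<le> R' \<longleftrightarrow> N + S + 1 \<le> 2 * R'" for R'
    unfolding Rmin by (rule nat_ceiling_half_le_iff)
  have adm: "admissible N S Rmin Qmin"
    using Rmin_le[of Rmin] by (auto simp: admissible_def Qmin)
  have minimal: "Rmin \<le> R' \<and> Qmin \<le> Q'" if "admissible N S R' Q'" for R' Q'
    using that by (auto simp: admissible_def Rmin_le Qmin)
  have "card ((\<lambda>(\<alpha>, \<beta>). nn \<alpha> \<beta>) ` ({1..R} \<times> {0..<Q})) = R * Q"
  proof -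
    have "inj_on (\<lambda>(\<alpha>, \<beta>). nn \<alpha> \<beta>) ({1..R} \<times> {0..<Q})"
      unfolding nn using zeros xZ by (intro inj_on_node_point) (auto simp: bij_betw_def)
    then show ?thesis by (simp add: card_image)
  qed
  then show ?thesis
    using wpos sphere formula adm minimal Rmin Qmin by (auto simp: mult.commute)
qed

end
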